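(* Let $b$ be a positive constant. There exists a constant $c_b$, depending only on $b$, such that the following holds. Let $\Gamma$ be a finite collection of curves in $\mathbb{R}^3$ such that each $\gamma\in\Gamma$ is parametrised by $t\mapsto\big(p_1^\gamma(t),p_2^\gamma(t),p_3^\gamma(t)\big)$ for $t\in\mathbb{R}$, where $p_1^\gamma,p_2^\gamma,p_3^\gamma\in\mathbb{R}[t]$ are polynomials, not simultaneously constant, of degrees at most $b$. Let $J$ be the set of joints formed by $\Gamma$. Then $$\sum_{x\in J}N(x)^{1/2}\leq c_b\cdot|\Gamma|^{3/2},$$ where $N(x)$ denotes the multiplicity of the joint $x$ for $\Gamma$.
   Context: Let $\mathcal{F}$ be the family of all non-empty sets $\gamma\subset\mathbb{R}^3$ such that for each $x\in\gamma$ a basic neighbourhood of $x$ in $\gamma$ is either $\{x\}$ or a finite union of parametrised curves, each homeomorphic to a semi-open line segment with one endpoint $x$. (Curves in $\mathbb{R}^3$ parametrised by real polynomials belong to $\mathcal{F}$.) If one of these curves has a parametrisation $f:[0,1)\to\mathbb{R}^3$ with $f(0)=x$ and $f'(0)\neq 0$, then the line through $x$ with direction $f'(0)$ is said to be tangent to $\gamma$ at $x$ (there may be several tangent lines to $\gamma$ at $x$, or none). For $\Gamma\subset\mathcal{F}$, $T_x^\Gamma$ denotes the set of directions of all tangent lines at $x$ to the sets of $\Gamma$ passing through $x$. A point $x\in\mathbb{R}^3$ is a joint for $\Gamma$ if $x$ belongs to at least one set in $\Gamma$ and there exist at least 3 vectors in $T_x^\Gamma$ spanning $\mathbb{R}^3$.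 The multiplicity $N(x)$ of the joint $x$ is the number of (unordered) triples of lines in $\mathbb{R}^3$ passing through $x$ whose directions are linearly independent vectors in $T_x^\Gamma$. *)

theory Defs
  imports
    "HOL-Analysis.Analysis"
    "HOL-Computational_Algebra.Polynomial"
begin

text \<open>
  A curve that is homeomorphic to a semi-open line segment is given by a homeomorphism defined on
  \<open>{0..<1}\<close>, under which the endpoint of the segment corresponds to the parameter \<open>0\<close>.
\<close>

definition branch_param :: "real^3 \<Rightarrow> (real^3) set \<Rightarrow> (real \<Rightarrow> real^3) \<Rightarrow> bool" where
  "branch_param x C f \<longleftrightarrow> (\<exists>g. homeomorphism {0..<1} C f g) \<and> f 0 = x"

definition branch_nbhd :: "(real^3) set \<Rightarrow> real^3 \<Rightarrow> (real^3) set set \<Rightarrow> bool" where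
  "branch_nbhd \<gamma> x \<C> \<longleftrightarrow>
     finite \<C> \<and> (\<forall>C\<in>\<C>. \<exists>f. branch_param x C f) \<and>
     \<Union>\<C> \<subseteq> \<gamma> \<and> (\<exists>U. openin (top_of_set \<gamma>) U \<and> x \<in> U \<and> U \<subseteq> \<Union>\<C>)"

text \<open>
  The family of sets for which tangent lines are considered. ``Basic neighbourhood'' means that
  the neighbourhoods of the stated shape form a local base. Neighbourhoods need not be open.
\<close>

definition curve_family :: "(real^3) set set" where
  "curve_family =
     {\<gamma>. \<gamma> \<noteq> {} \<and>
        (\<forall>x\<in>\<gamma>. \<forall>W. open W \<and> x \<in> W \<longrightarrow>
           openin (top_of_set \<gamma>) {x} \<or> (\<exists>\<C>. branch_nbhd \<gamma> x \<C> \<and> \<Union>\<C> \<subseteq> W))}"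

definition line_through :: "real^3 \<Rightarrow> real^3 \<Rightarrow> (real^3) set" where
  "line_through x d = range (\<lambda>s. x + s *\<^sub>R d)"

text \<open>
  The derivative at \<open>0\<close> is one-sided, and \<open>f\<close> need not be differentiable elsewhere.
\<close>

definition tangent_line :: "(real^3) set \<Rightarrow> real^3 \<Rightarrow> (real^3) set \<Rightarrow> bool" where
  "tangent_line \<gamma> x L \<longleftrightarrow>
     (\<exists>\<C> C f d. branch_nbhd \<gamma> x \<C> \<and> C \<in> \<C> \<and> branch_param x C f \<and>
        (f has_vector_derivative d) (at 0 within {0..<1}) \<and> d \<noteq> 0 \<and> L = line_through x d)"

text \<open>
  A line has all nonzero multiples of a direction vector as directions, so the set of tangent
  directions is closed under multiplication by nonzero scalars.
\<close>

definition tangent_directions :: "(real^3) set set \<Rightarrow> real^3 \<Rightarrow> (real^3) set" where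
  "tangent_directions \<Gamma> x =
     {v. v \<noteq> 0 \<and> (\<exists>\<gamma>\<in>\<Gamma>. x \<in> \<gamma> \<and> tangent_line \<gamma> x (line_through x v))}"

definition is_joint :: "(real^3) set set \<Rightarrow> real^3 \<Rightarrow> bool" where
  "is_joint \<Gamma> x \<longleftrightarrow>
     (\<exists>\<gamma>\<in>\<Gamma>. x \<in> \<gamma>) \<and>
     (\<exists>u\<in>tangent_directions \<Gamma> x. \<exists>v\<in>tangent_directions \<Gamma> x. \<exists>w\<in>tangent_directions \<Gamma> x.
        span {u, v, w} = UNIV)"

definition joints :: "(real^3) set set \<Rightarrow> (real^3) set" where
  "joints \<Gamma> = {x. is_joint \<Gamma> x}"

definition joint_triples :: "(real^3) set set \<Rightarrow> real^3 \<Rightarrow> (real^3) set set set" where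
  "joint_triples \<Gamma> x =
     {{line_through x u, line_through x v, line_through x w} | u v w.
        u \<in> tangent_directions \<Gamma> x \<and> v \<in> tangent_directions \<Gamma> x \<and> w \<in> tangent_directions \<Gamma> x \<and>
        distinct [u, v, w] \<and> independent {u, v, w}}"

text \<open>
  As \<open>card\<close> of an infinite set is \<open>0\<close>, this is meaningful only if \<open>joint_triples \<Gamma> x\<close> is finite.
\<close>

definition multiplicity_joint :: "(real^3) set set \<Rightarrow> real^3 \<Rightarrow> nat" where
  "multiplicity_joint \<Gamma> x = card (joint_triples \<Gamma> x)"

definition poly_curve :: "real poly \<Rightarrow> real poly \<Rightarrow> real poly \<Rightarrow> real \<Rightarrow> real^3" where
  "poly_curve p1 p2 p3 t = vector [poly p1 t, poly p2 t, poly p3 t]"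

lemma poly_inj_on_right:
  fixes q :: "real poly"
  assumes "degree q > 0"
  shows "\<exists>e>0. inj_on (poly q) {0..e}"
proof -
  have nz: "pderiv q \<noteq> 0"
    using assms by (simp add: pderiv_eq_0_iff)
  let ?R = "insert 1 {z. poly (pderiv q) z = 0 \<and> 0 < z}"
  have fin: "finite ?R"
    using poly_roots_finite[OF nz] by (auto intro: finite_subset)
  define e where "e = Min ?R"
  have e: "e > 0" using fin by (auto simp: e_def)
  have noroot: "poly (pderiv q) z \<noteq> 0" if "0 < z" "z < e" for z
    using that fin Min_le[OF fin, of z] by (auto simp: e_def)
  have lt: "poly q u \<noteq> poly q v" if "0 \<le> u" "u < v" "v \<le> e" for u v
    using poly_MVT[OF \<open>u < v\<close>, of q] noroot that by force
  have "inj_on (poly q) {0..e}"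
    unfolding inj_on_def using lt by (metis atLeastAtMost_iff linorder_neqE_linordered_idom)
  with e show ?thesis by blast
qed

lemma range_in_curve_family:
  fixes P :: "real \<Rightarrow> real^3" and p :: "real poly"
  assumes cont: "continuous_on UNIV P" and p: "degree p > 0" "\<And>t. P t $ i = poly p t"
  shows "range P \<in> curve_family"
proof -
  have "\<exists>\<C>. branch_nbhd (range P) x \<C> \<and> \<Union>\<C> \<subseteq> W" if x: "x \<in> range P" and W: "open W" "x \<in> W" for x W
  proof -
    define Z where "Z = {t. P t = x}"
    have "finite {t. poly (p - [:x $ i:]) t = 0}"
      by (rule poly_roots_finite) (use p(1) in auto)
    then have finZ: "finite Z"
      by (rule rev_finite_subset) (auto simp: Z_def simp flip: p(2))
    have "\<exists>e>0. inj_on (\<lambda>u. P (t + s * u)) {0..e} \<and> (\<forall>u\<in>{0..e}. P (t + s * u) \<in> W)"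
      if t: "t \<in> Z" and s: "s \<in> {1, -1::real}" for t s
    proof -
      have "degree (p \<circ>\<^sub>p [:t, s:]) > 0" using p(1) s by (auto simp: degree_pcompose)
      from poly_inj_on_right[OF this] obtain e where e: "e > 0" "inj_on (poly (p \<circ>\<^sub>p [:t, s:])) {0..e}"
        by blast
      have inj: "inj_on (\<lambda>u. P (t + s * u)) {0..e}"
      proof (rule inj_onI)
        fix u v assume uv: "u \<in> {0..e}" "v \<in> {0..e}" "P (t + s * u) = P (t + s * v)"
        then have "P (t + s * u) $ i = P (t + s * v) $ i" by simp
        then have "poly (p \<circ>\<^sub>p [:t, s:]) u = poly (p \<circ>\<^sub>p [:t, s:]) v"
          by (simp add: poly_pcompose p(2) mult.commute)
        then show "u = v" using inj_onD[OF e(2)] uv(1,2) by blast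
      qed
      have "open (P -` W)" using cont W(1) by (simp add: open_vimage)
      moreover have "t \<in> P -` W" using t W(2) by (auto simp: Z_def)
      ultimately obtain d where d: "d > 0" "cball t d \<subseteq> P -` W"
        using open_contains_cball by blast
      have "P (t + s * u) \<in> W" if "u \<in> {0..min d e}" for u
      proof -
        have "t + s * u \<in> cball t d" using that s by (auto simp: dist_real_def)
        then show ?thesis using d(2) by blast
      qed
      moreover have "inj_on (\<lambda>u. P (t + s * u)) {0..min d e}"
        using inj by (rule inj_on_subset) auto
      ultimately show ?thesis using d(1) e(1) by (intro exI[of _ "min d e"]) auto
    qed
    then obtain e where e: "\<And>t s. t \<in> Z \<Longrightarrow> s \<in> {1, -1::real} \<Longrightarrow> e t s > (0::real)"
      "\<And>t s. t \<in> Z \<Longrightarrow> s \<in> {1, -1::real} \<Longrightarrow> inj_on (\<lambda>u. P (t + s * u)) {0..e t s}"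
      "\<And>t s u. t \<in> Z \<Longrightarrow> s \<in> {1, -1::real} \<Longrightarrow> u \<in> {0..e t s} \<Longrightarrow> P (t + s * u) \<in> W"
      by metis
    define f where "f t s v = P (t + s * (e t s * v))" for t s v
    define \<C> where "\<C> = (\<lambda>(t, s). f t s ` {0..<1}) ` (Z \<times> {1, -1})"
    have branch: "branch_param x (f t s ` {0..<1}) (f t s)" if ts: "t \<in> Z" "s \<in> {1, -1}" for t s
    proof -
      have "inj_on (f t s) {0..1}"
      proof (rule inj_onI)
        fix a b :: real
        assume ab: "a \<in> {0..1}" "b \<in> {0..1}" "f t s a = f t s b"
        have "e t s * a \<in> {0..e t s}" "e t s * b \<in> {0..e t s}"
          using ab(1,2) e(1)[OF ts] by (auto simp: mult_le_cancel_left1)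
        then have "e t s * a = e t s * b"
          by (intro inj_onD[OF e(2)[OF ts] ab(3)[unfolded f_def]])
        then show "a = b" using e(1)[OF ts] by simp
      qed
      moreover have "continuous_on {0..1} (f t s)"
        unfolding f_def by (rule continuous_on_compose2[OF cont]) (auto intro!: continuous_intros)
      ultimately obtain g where g: "homeomorphism {0..1} (f t s ` {0..1}) (f t s) g"
        using homeomorphism_compact[of "{0..1}" "f t s"] by blast
      have "homeomorphism {0..<1} (f t s ` {0..<1}) (f t s) g"
        by (rule homeomorphism_of_subsets[OF g]) auto
      moreover have "f t s 0 = x" using ts by (simp add: f_def Z_def)
      ultimately show ?thesis unfolding branch_param_def by blast
    qed
    define V where "V = (\<Union>t\<in>Z. {t - e t (-1) <..< t + e t 1})"
    have inV: "P r \<in> \<Union>\<C>" if "r \<in> V" for r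
    proof -
      from that obtain t where t: "t \<in> Z" "t - e t (-1) < r" "r < t + e t 1"
        by (auto simp: V_def)
      define s :: real where "s = (if r \<ge> t then 1 else -1)"
      have s: "s \<in> {1, -1}" by (simp add: s_def)
      have pos: "e t s > 0" using e(1)[OF t(1) s] .
      have "\<bar>r - t\<bar> / e t s \<in> {0..<1}" using t pos by (auto simp: s_def)
      moreover have "P r = f t s (\<bar>r - t\<bar> / e t s)"
        using pos by (auto simp: f_def s_def)
      ultimately show ?thesis using t(1) s unfolding \<C>_def by blast
    qed
    have "filterlim (poly p) at_infinity at_infinity" by (rule filterlim_poly_at_infinity[OF p(1)])
    then have "\<forall>\<^sub>F t in at_infinity. norm (poly p t) \<ge> \<bar>x $ i\<bar> + 1"
      using filterlim_at_infinity[of 0 "poly p"] by (simp add: add_nonneg_pos)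
    then obtain R where R: "\<And>t. \<bar>t\<bar> \<ge> R \<Longrightarrow> \<bar>P t $ i\<bar> \<ge> \<bar>x $ i\<bar> + 1"
      by (auto simp: eventually_at_infinity p(2))
    define A where "A = P ` ({-R..R} - V)"
    have "open V" by (auto simp: V_def)
    then have "compact ({-R..R} - V)" by (simp add: compact_diff)
    then have "compact A" unfolding A_def
      by (rule compact_continuous_image[OF continuous_on_subset[OF cont], rotated]) auto
    define U where "U = range P \<inter> ({y. \<bar>y $ i\<bar> < \<bar>x $ i\<bar> + 1} - A)"
    have "open {y::real^3. \<bar>y $ i\<bar> < \<bar>x $ i\<bar> + 1}"
      by (intro open_Collect_less continuous_intros)
    with \<open>compact A\<close> have "open ({y. \<bar>y $ i\<bar> < \<bar>x $ i\<bar> + 1} - A)"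
      by (simp add: open_Diff compact_imp_closed)
    then have "openin (top_of_set (range P)) U"
      unfolding U_def by (rule openin_open_Int)
    moreover have "x \<in> U"
    proof -
      have "t \<in> {t - e t (-1) <..< t + e t 1}" if "t \<in> Z" for t
        using e(1)[OF that, of 1] e(1)[OF that, of "-1"] by simp
      then have "Z \<subseteq> V" unfolding V_def by blast
      then have "x \<notin> A" by (auto simp: A_def Z_def)
      then show ?thesis using x by (auto simp: U_def)
    qed
    moreover have "U \<subseteq> \<Union>\<C>"
    proof
      fix y assume y: "y \<in> U"
      then obtain r where r: "y = P r" by (auto simp: U_def)
      have "\<bar>P r $ i\<bar> < \<bar>x $ i\<bar> + 1" "P r \<notin> A" using y r by (auto simp: U_def)
      then have "\<bar>r\<bar> < R" using R[of r] by linarith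
      then have "r \<in> {-R..R}" by auto
      with \<open>P r \<notin> A\<close> have "r \<in> V" unfolding A_def by blast
      then show "y \<in> \<Union>\<C>" using inV r by simp
    qed
    moreover have "finite \<C>" using finZ by (simp add: \<C>_def)
    moreover have "\<forall>C\<in>\<C>. \<exists>f. branch_param x C f" using branch by (auto simp: \<C>_def)
    moreover have "\<Union>\<C> \<subseteq> range P" by (auto simp: \<C>_def f_def)
    moreover have "\<Union>\<C> \<subseteq> W"
    proof -
      have "f t s v \<in> W" if "t \<in> Z" "s \<in> {1, -1}" "v \<in> {0..<1}" for t s v
      proof -
        have "e t s * v \<in> {0..e t s}"
          using that(3) e(1)[OF that(1,2)] by (auto simp: mult_le_cancel_left1)
        then show ?thesis unfolding f_def by (rule e(3)[OF that(1,2)])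
      qed
      then show ?thesis by (auto simp: \<C>_def)
    qed
    ultimately show ?thesis unfolding branch_nbhd_def by blast
  qed
  then show ?thesis unfolding curve_family_def by blast
qed

text \<open>
  Hence the results about polynomial curves need no separate hypothesis that they belong to
  \<open>curve_family\<close>.
\<close>

lemma poly_curve_in_curve_family:
  assumes "\<not> (degree p1 = 0 \<and> degree p2 = 0 \<and> degree p3 = 0)"
  shows "range (poly_curve p1 p2 p3) \<in> curve_family"
proof -
  have comp: "poly_curve p1 p2 p3 t $ 1 = poly p1 t" "poly_curve p1 p2 p3 t $ 2 = poly p2 t"
    "poly_curve p1 p2 p3 t $ 3 = poly p3 t" for t
    by (simp_all add: poly_curve_def)
  have "continuous_on UNIV (\<lambda>t. poly_curve p1 p2 p3 t $ i)" for i
    using exhaust_3[of i] by (elim disjE) (simp_all add: comp continuous_on_poly)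
  then have "continuous_on UNIV (\<lambda>t. \<chi> i. poly_curve p1 p2 p3 t $ i)"
    by (rule continuous_on_vec_lambda)
  then have cont: "continuous_on UNIV (poly_curve p1 p2 p3)" by simp
  show ?thesis
    using assms range_in_curve_family[OF cont, of p1 1] range_in_curve_family[OF cont, of p2 2]
      range_in_curve_family[OF cont, of p3 3] by (auto simp: comp)
qed

end

theory Submission
  imports Defs
begin

text \<open>
  The proof is the polynomial method with multiplicities, in the form that Zhang and later Tidor, Yu and
  Zhao gave to it. At each joint \<open>p\<close> fix non-negative integers \<open>b p \<gamma>\<close> for the curves \<open>\<gamma>\<close> through \<open>p\<close>. If
  three curves with independent tangents are chosen at each joint, one can ask for a polynomial \<open>F\<close>
  of degree at most \<open>n\<close> that has, in coordinates along the three tangents at \<open>p\<close>, no monomial in the box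
  whose sides are the three numbers \<open>b p \<gamma>\<close>. For suitable \<open>b\<close>, with \<open>\<Sum>p\<in>\<gamma>. b p \<gamma>\<close> only a constant multiple of
  \<open>n\<close> for each \<open>\<gamma>\<close>, these conditions force \<open>F = 0\<close>: a polynomial that
  violates this has a derivative with too many zeros on one of the curves. Comparing dimensions, the
  products of three weights, summed over the joints, are at least of order \<open>n ^ 3\<close>
  (lemma \<open>dimension_count\<close>).

  The suitable weights have the form \<open>b p \<gamma> = max (k \<gamma> - \<delta> p) 0\<close>, where \<open>\<delta>\<close> is arbitrary and \<open>k \<gamma>\<close> is
  determined by the sum over \<open>\<gamma>\<close>: water is poured on each curve over floors of heights \<open>\<delta> p\<close>. The
  freedom in \<open>\<delta>\<close> allows the contributions of the joints to be prescribed: for given \<open>\<tau>\<close> with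
  \<open>\<Sum>p. \<tau> p\<close> below the dimension, all independent triples at all joints \<open>p\<close> have product at
  least \<open>\<tau> p\<close> (lemma \<open>balanced_weights\<close>).

  Summing over the \<open>N p\<close> triples at \<open>p\<close> gives \<open>N p * \<tau> p \<le> (\<Sum>\<gamma>. b p \<gamma>) ^ 3\<close>, up to constants. With \<open>\<tau>\<close>
  proportional to \<open>sqrt (N p)\<close>, cube roots and summation over \<open>p\<close> give the theorem
  (lemma \<open>sum_sqrt_multiplicity_le\<close>).

  Tangent lines are defined by arbitrary parametrisations of branches. For a polynomial curve
  each of them is spanned by the lowest order term of the parametrisation at some
  time (lemma \<open>tangent_direction_is_leading\<close>), which is all that the algebraic part uses.
\<close>

section \<open>Underdetermined linear systems\<close>

lemma underdetermined_system_has_solution: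
  fixes M :: "'k \<Rightarrow> 'i \<Rightarrow> real"
  assumes "finite K" "finite I" "card K < card I"
  shows "\<exists>a. (\<exists>i\<in>I. a i \<noteq> 0) \<and> (\<forall>k\<in>K. (\<Sum>i\<in>I. M k i * a i) = 0)"
  using assms
proof (induction K arbitrary: I M rule: finite_induct)
  case empty
  then have "I \<noteq> {}" by auto
  then show ?case by (intro exI[of _ "\<lambda>_. 1"]) auto
next
  case (insert k K)
  show ?case
  proof (cases "\<forall>i\<in>I. M k i = 0")
    case True
    have "card K < card I" using insert by simp
    then obtain a where "\<exists>i\<in>I. a i \<noteq> 0" "\<forall>l\<in>K. (\<Sum>i\<in>I. M l i * a i) = 0"
      using insert.IH[OF insert.prems(1)] by blast
    then show ?thesis using True by (intro exI[of _ a]) (simp add: sum.neutral)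
  next
    case False
    then obtain i0 where i0: "i0 \<in> I" "M k i0 \<noteq> 0" by blast
    define I' where "I' = I - {i0}"
    define M' where "M' l i = M l i - M l i0 * M k i / M k i0" for l i
    have I': "finite I'" "card K < card I'" "i0 \<notin> I'" "I = insert i0 I'"
      using insert i0 by (auto simp: I'_def)
    obtain a where a: "\<exists>i\<in>I'. a i \<noteq> 0" "\<forall>l\<in>K. (\<Sum>i\<in>I'. M' l i * a i) = 0"
      using insert.IH[OF I'(1,2)] by blast
    define c where "c = (\<Sum>i\<in>I'. M k i * a i)"
    define a' where "a' = a(i0 := - c / M k i0)"
    have row: "(\<Sum>i\<in>I. M l i * a' i) = (\<Sum>i\<in>I'. M l i * a i) - M l i0 * c / M k i0" for l
    proof -
      have "(\<Sum>i\<in>I'. M l i * a' i) = (\<Sum>i\<in>I'. M l i * a i)"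
        using I'(3) by (intro sum.cong) (auto simp: a'_def)
      then show ?thesis using I' by (simp add: a'_def)
    qed
    have "(\<Sum>i\<in>I'. M' l i * a i) = (\<Sum>i\<in>I'. M l i * a i) - M l i0 * c / M k i0" for l
      by (simp add: M'_def c_def left_diff_distrib sum_subtractf sum_distrib_left
            sum_divide_distrib mult.assoc)
    then have "\<forall>l\<in>K. (\<Sum>i\<in>I. M l i * a' i) = 0" using a(2) row by simp
    moreover have "(\<Sum>i\<in>I. M k i * a' i) = 0" using row[of k] i0 by (simp add: c_def)
    moreover have "\<exists>i\<in>I. a' i \<noteq> 0" using a(1) I' by (auto simp: a'_def)
    ultimately show ?thesis by (intro exI[of _ a']) auto
  qed
qed

text \<open>
  Comparing coefficients of a one-variable polynomial whose terms are collected by an exponent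
  \<open>\<phi>\<close>. With \<open>\<phi>\<close> one of three exponents it separates the variables of a trivariate polynomial;
  with \<open>\<phi>\<close> the total degree it separates homogeneous parts.
\<close>

lemma sum_of_powers_eq_0_imp_graded_part_eq_0:
  fixes B :: "'a \<Rightarrow> real"
  assumes "finite S" "\<And>s. (\<Sum>g\<in>S. B g * s ^ \<phi> g) = 0"
  shows "(\<Sum>g | g \<in> S \<and> \<phi> g = m. B g) = 0"
proof -
  define p where "p = (\<Sum>g\<in>S. monom (B g) (\<phi> g))"
  have "poly p s = 0" for s using assms(2)[of s] by (simp add: p_def poly_sum poly_monom)
  then have "p = 0" using poly_all_0_iff_0 by blast
  then have "coeff p m = 0" by simp
  moreover have "coeff p m = (\<Sum>g\<in>S. if \<phi> g = m then B g else 0)"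
    unfolding p_def coeff_sum by (intro sum.cong) auto
  ultimately show ?thesis using sum.inter_filter[OF assms(1)] by metis
qed

section \<open>Trivariate polynomials and changes of affine frame\<close>

text \<open>
  A trivariate polynomial is a family of real coefficients indexed by exponent triples. Monomials are
  polymorphic because they are evaluated in the reals and in \<open>real poly poly\<close>.
\<close>

type_synonym index = "nat \<times> nat \<times> nat"

fun mon :: "'a::comm_monoid_mult \<Rightarrow> 'a \<Rightarrow> 'a \<Rightarrow> index \<Rightarrow> 'a" where
  "mon x y z (i, j, k) = x ^ i * y ^ j * z ^ k"

fun mdeg :: "index \<Rightarrow> nat" where
  "mdeg (i, j, k) = i + j + k"

definition indices :: "nat \<Rightarrow> index set" where
  "indices n = {g. mdeg g \<le> n}"

lemma finite_indices: "finite (indices n)"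
proof (rule finite_subset)
  show "indices n \<subseteq> {..n} \<times> {..n} \<times> {..n}" by (auto simp: indices_def)
qed auto

text \<open>
  Only the order of magnitude of the binomial coefficient matters, so a cube inside the simplex is enough.
\<close>

lemma card_indices: "m ^ 3 < card (indices (3 * m))"
proof -
  have "{..m} \<times> {..m} \<times> {..m} \<subseteq> indices (3 * m)" by (auto simp: indices_def)
  from card_mono[OF finite_indices this] have "(m + 1) ^ 3 \<le> card (indices (3 * m))"
    by (simp add: card_cartesian_product power3_eq_cube mult.assoc del: mult_Suc mult_Suc_right)
  moreover have "m ^ 3 < (m + 1) ^ 3" by (intro power_strict_mono) auto
  ultimately show ?thesis by linarith
qed

lemma mon_altdef: "mon x y z g = x ^ fst g * y ^ fst (snd g) * z ^ snd (snd g)"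
  by (cases g) simp

lemma mon_scale: "mon (c * x) (c * y) (c * z) g = c ^ mdeg g * mon x y z g"
  by (cases g) (simp add: power_mult_distrib power_add mult_ac)

lemma coeffs_eq_0_if_vanishing:
  fixes A :: "index \<Rightarrow> real"
  assumes fin: "finite S" and 0: "\<And>x y z. (\<Sum>g\<in>S. A g * mon x y z g) = 0" and g: "g \<in> S"
  shows "A g = 0"
proof -
  obtain i j k where ijk: "g = (i, j, k)" by (cases g)
  let ?S1 = "{g\<in>S. snd (snd g) = k}"
  let ?S2 = "{g\<in>?S1. fst (snd g) = j}"
  have "(\<Sum>g\<in>?S1. A g * x ^ fst g * y ^ fst (snd g)) = 0" for x y
  proof (rule sum_of_powers_eq_0_imp_graded_part_eq_0[OF fin])
    show "(\<Sum>g\<in>S. A g * x ^ fst g * y ^ fst (snd g) * z ^ snd (snd g)) = 0" for z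
      using 0[of x y z] by (simp add: mon_altdef mult.assoc)
  qed
  then have "(\<Sum>g\<in>?S2. A g * x ^ fst g) = 0" for x
    using sum_of_powers_eq_0_imp_graded_part_eq_0[of ?S1 "\<lambda>g. A g * x ^ fst g" "\<lambda>g. fst (snd g)" j] fin
    by simp
  then have "(\<Sum>g | g \<in> ?S2 \<and> fst g = i. A g) = 0"
    using sum_of_powers_eq_0_imp_graded_part_eq_0[of ?S2 A fst i] fin by simp
  moreover have "{g. g \<in> ?S2 \<and> fst g = i} = {g}" using g ijk by auto
  ultimately show ?thesis by simp
qed

text \<open>
  Functions of three real variables given by a polynomial of total degree at most \<open>n\<close>, as a property
  of the function: the coefficients in a new frame have to exist, but are never computed.
\<close>

definition polyfun3 :: "nat \<Rightarrow> (real \<Rightarrow> real \<Rightarrow> real \<Rightarrow> real) \<Rightarrow> bool" where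
  "polyfun3 n F \<longleftrightarrow> (\<exists>M. \<forall>x y z. F x y z = (\<Sum>g\<in>indices n. M g * mon x y z g))"

lemma polyfun3_mon:
  assumes "mdeg g \<le> n" shows "polyfun3 n (\<lambda>x y z. mon x y z g)"
proof -
  have "mon x y z g = (\<Sum>h\<in>indices n. (if g = h then 1 else 0) * mon x y z h)" for x y z :: real
  proof -
    have "(\<Sum>h\<in>indices n. (if g = h then 1 else 0) * mon x y z h) =
        (\<Sum>h\<in>indices n. if g = h then mon x y z h else 0)"
      by (intro sum.cong) auto
    also have "\<dots> = mon x y z g" using assms finite_indices by (subst sum.delta') (auto simp: indices_def)
    finally show ?thesis by simp
  qed
  then show ?thesis unfolding polyfun3_def
    by (intro exI[of _ "\<lambda>h. if g = h then 1 else 0"] allI)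
qed

lemma polyfun3_scale:
  assumes "polyfun3 n F" shows "polyfun3 n (\<lambda>x y z. c * F x y z)"
proof -
  obtain M where "\<And>x y z. F x y z = (\<Sum>g\<in>indices n. M g * mon x y z g)"
    using assms by (auto simp: polyfun3_def)
  then show ?thesis unfolding polyfun3_def
    by (intro exI[of _ "\<lambda>g. c * M g"]) (simp add: sum_distrib_left mult.assoc)
qed

lemma polyfun3_add:
  assumes "polyfun3 n F" "polyfun3 n G" shows "polyfun3 n (\<lambda>x y z. F x y z + G x y z)"
proof -
  obtain M N where "\<And>x y z. F x y z = (\<Sum>g\<in>indices n. M g * mon x y z g)"
    "\<And>x y z. G x y z = (\<Sum>g\<in>indices n. N g * mon x y z g)"
    using assms by (auto simp: polyfun3_def)
  then show ?thesis unfolding polyfun3_def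
    by (intro exI[of _ "\<lambda>g. M g + N g"]) (simp add: sum.distrib distrib_right)
qed

lemma polyfun3_sum:
  "finite S \<Longrightarrow> (\<And>g. g \<in> S \<Longrightarrow> polyfun3 n (F g)) \<Longrightarrow> polyfun3 n (\<lambda>x y z. \<Sum>g\<in>S. F g x y z)"
proof (induction S rule: finite_induct)
  case empty
  show ?case unfolding polyfun3_def by (intro exI[of _ "\<lambda>_. 0"]) simp
next
  case (insert g S)
  then show ?case by (simp add: polyfun3_add)
qed

lemma polyfun3_mult_affine:
  assumes "polyfun3 n F"
  shows "polyfun3 (Suc n) (\<lambda>x y z. (d + x * a + y * b + z * c) * F x y z)"
proof -
  obtain M where M: "\<And>x y z. F x y z = (\<Sum>g\<in>indices n. M g * mon x y z g)"
    using assms by (auto simp: polyfun3_def)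
  have "polyfun3 (Suc n) (\<lambda>x y z. \<Sum>g\<in>indices n. M g * ((d + x * a + y * b + z * c) * mon x y z g))"
  proof (intro polyfun3_sum polyfun3_scale finite_indices)
    fix g assume "g \<in> indices n"
    then obtain i j k where g: "g = (i, j, k)" "i + j + k \<le> n" by (cases g) (auto simp: indices_def)
    have "polyfun3 (Suc n) (\<lambda>x y z. d * mon x y z (i, j, k) + a * mon x y z (Suc i, j, k)
        + b * mon x y z (i, Suc j, k) + c * mon x y z (i, j, Suc k))"
      by (intro polyfun3_add polyfun3_scale polyfun3_mon) (use g in auto)
    then show "polyfun3 (Suc n) (\<lambda>x y z. (d + x * a + y * b + z * c) * mon x y z g)"
      by (simp add: g algebra_simps)
  qed
  moreover have "(d + x * a + y * b + z * c) * F x y z =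
      (\<Sum>g\<in>indices n. M g * ((d + x * a + y * b + z * c) * mon x y z g))" for x y z
    unfolding M sum_distrib_left by (intro sum.cong) (auto simp: mult_ac)
  ultimately show ?thesis by presburger
qed

lemma polyfun3_mult_affine_power:
  assumes "polyfun3 n F"
  shows "polyfun3 (m + n) (\<lambda>x y z. (d + x * a + y * b + z * c) ^ m * F x y z)"
proof (induction m)
  case 0
  then show ?case using assms by simp
next
  case (Suc m)
  from polyfun3_mult_affine[OF this, of d a b c] show ?case by (simp add: mult.assoc)
qed

definition in_frame :: "real^3 \<Rightarrow> real^3 \<Rightarrow> real^3 \<Rightarrow> real \<Rightarrow> real \<Rightarrow> real \<Rightarrow> real^3" where
  "in_frame u v w x y z = x *\<^sub>R u + y *\<^sub>R v + z *\<^sub>R w"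

lemma polyfun3_mono:
  assumes "polyfun3 m F" "m \<le> n" shows "polyfun3 n F"
proof -
  obtain M where M: "\<And>x y z. F x y z = (\<Sum>g\<in>indices m. M g * mon x y z g)"
    using assms by (auto simp: polyfun3_def)
  have "polyfun3 n (\<lambda>x y z. \<Sum>g\<in>indices m. M g * mon x y z g)"
    by (intro polyfun3_sum polyfun3_scale polyfun3_mon finite_indices)
       (use assms in \<open>auto simp: indices_def\<close>)
  then show ?thesis by (simp add: M polyfun3_def)
qed

abbreviation vmon :: "real^3 \<Rightarrow> index \<Rightarrow> real" where
  "vmon x \<equiv> mon (x $ 1) (x $ 2) (x $ 3)"

text \<open>
  In any affine frame, each coordinate is an affine function of the frame coordinates, so the total
  degree does not increase.
\<close>

lemma recentre_monomial:
  assumes "mdeg g \<le> n"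
  shows "polyfun3 n (\<lambda>x y z. vmon (q + in_frame u v w x y z) g)"
proof -
  obtain i j k where g: "g = (i, j, k)" by (cases g)
  have "polyfun3 0 (\<lambda>x y z. 1)" using polyfun3_mon[of "(0, 0, 0)" 0] by simp
  then have "polyfun3 (i + (j + (k + 0)))
    (\<lambda>x y z. (q $ 1 + x * u $ 1 + y * v $ 1 + z * w $ 1) ^ i *
      ((q $ 2 + x * u $ 2 + y * v $ 2 + z * w $ 2) ^ j *
      ((q $ 3 + x * u $ 3 + y * v $ 3 + z * w $ 3) ^ k * 1)))"
    by (intro polyfun3_mult_affine_power)
  then have "polyfun3 n (\<lambda>x y z. (q $ 1 + x * u $ 1 + y * v $ 1 + z * w $ 1) ^ i *
      ((q $ 2 + x * u $ 2 + y * v $ 2 + z * w $ 2) ^ j *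
      ((q $ 3 + x * u $ 3 + y * v $ 3 + z * w $ 3) ^ k * 1)))"
    by (rule polyfun3_mono) (use assms g in auto)
  then show ?thesis by (simp add: g in_frame_def mult.assoc add.assoc)
qed

section \<open>Polynomials along a curve\<close>

definition curve_pt :: "(3 \<Rightarrow> real poly) \<Rightarrow> real \<Rightarrow> real^3" where
  "curve_pt P t = (\<chi> i. poly (P i) t)"

definition expands :: "nat \<Rightarrow> (real^3 \<Rightarrow> real) \<Rightarrow> real^3 \<Rightarrow> (index \<Rightarrow> real) \<Rightarrow> bool" where
  "expands n F q A \<longleftrightarrow> (\<forall>x. F (q + x) = (\<Sum>g\<in>indices n. A g * vmon x g))"

text \<open>
  If \<open>A\<close> expands \<open>F\<close> at \<open>q\<close>, this is the polynomial \<open>F (P(t) + s u)\<close>, with \<open>s\<close> as the outer and \<open>t\<close> as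
  the inner variable. Its coefficient of \<open>s ^ e\<close> is, up to a factorial, the derivative of order \<open>e\<close>
  of \<open>F\<close> in direction \<open>u\<close>, restricted to the curve.
\<close>

definition along_curve :: "nat \<Rightarrow> (index \<Rightarrow> real) \<Rightarrow> real^3 \<Rightarrow> (3 \<Rightarrow> real poly) \<Rightarrow> real^3 \<Rightarrow> real poly poly" where
  "along_curve n A q P u = (let X = \<lambda>i. [:P i - [:q $ i:], [:u $ i:]:] in
     \<Sum>g\<in>indices n. [:[:A g:]:] * mon (X 1) (X 2) (X 3) g)"

lemma poly_mon [simp]: "poly (mon x y z g) c = mon (poly x c) (poly y c) (poly z c) g"
  by (cases g) simp

lemma poly_along_curve:
  assumes "expands n F q A"
  shows "poly (poly (along_curve n A q P u) [:s:]) t = F (curve_pt P t + s *\<^sub>R u)"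
proof -
  have "F (curve_pt P t + s *\<^sub>R u) = F (q + (curve_pt P t - q + s *\<^sub>R u))" by simp
  also have "\<dots> = (\<Sum>g\<in>indices n. A g * vmon (curve_pt P t - q + s *\<^sub>R u) g)"
    using assms unfolding expands_def by blast
  finally show ?thesis by (simp add: along_curve_def Let_def poly_sum curve_pt_def mult.commute)
qed

lemma bivariate_poly_eqI:
  fixes \<Phi> \<Psi> :: "real poly poly"
  assumes "\<And>s t. poly (poly \<Phi> [:s:]) t = poly (poly \<Psi> [:s:]) t"
  shows "\<Phi> = \<Psi>"
proof (rule ccontr)
  assume "\<Phi> \<noteq> \<Psi>"
  then have "finite {c. poly (\<Phi> - \<Psi>) c = 0}" by (intro poly_roots_finite) simp
  moreover have "range (\<lambda>s. [:s:]) \<subseteq> {c. poly (\<Phi> - \<Psi>) c = 0}"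
    using assms by (auto intro!: poly_ext)
  moreover have "infinite (range (\<lambda>s::real. [:s:]))"
    using finite_imageD[of "\<lambda>s::real. [:s:]" UNIV] infinite_UNIV_char_0 by (auto simp: inj_on_def)
  ultimately show False using finite_subset by blast
qed

lemma along_curve_independent_of_centre:
  "expands n F q A \<Longrightarrow> expands n F r A' \<Longrightarrow> along_curve n A q P u = along_curve n A' r P u"
  by (rule bivariate_poly_eqI) (simp add: poly_along_curve)

definition coeff_deg_le :: "nat \<Rightarrow> real poly poly \<Rightarrow> bool" where
  "coeff_deg_le d \<Phi> \<longleftrightarrow> (\<forall>j. degree (coeff \<Phi> j) \<le> d)"

lemma coeff_deg_le_mult:
  assumes "coeff_deg_le d \<Phi>" "coeff_deg_le e \<Psi>"
  shows "coeff_deg_le (d + e) (\<Phi> * \<Psi>)"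
  unfolding coeff_deg_le_def coeff_mult
proof (intro allI degree_sum_le)
  fix j i
  show "degree (coeff \<Phi> i * coeff \<Psi> (j - i)) \<le> d + e"
    using assms degree_mult_le[of "coeff \<Phi> i" "coeff \<Psi> (j - i)"]
    by (meson coeff_deg_le_def add_mono order_trans)
qed auto

lemma coeff_deg_le_power: "coeff_deg_le d \<Phi> \<Longrightarrow> coeff_deg_le (m * d) (\<Phi> ^ m)"
proof (induction m)
  case 0
  then show ?case by (simp add: coeff_deg_le_def coeff_1)
next
  case (Suc m)
  then show ?case using coeff_deg_le_mult[of d \<Phi> "m * d" "\<Phi> ^ m"] by simp
qed

lemma coeff_deg_le_mon:
  assumes "coeff_deg_le d x" "coeff_deg_le d y" "coeff_deg_le d z"
  shows "coeff_deg_le (mdeg g * d) (mon x y z g)"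
proof -
  obtain i j k where g: "g = (i, j, k)" by (cases g)
  have "coeff_deg_le (i * d + j * d + k * d) (mon x y z g)"
    unfolding g mon.simps by (intro coeff_deg_le_mult coeff_deg_le_power assms)
  then show ?thesis by (simp add: g distrib_right)
qed

lemma degree_coeff_along_curve:
  assumes "\<And>i. degree (P i) \<le> B"
  shows "degree (coeff (along_curve n A q P u) e) \<le> n * B"
proof -
  have X: "coeff_deg_le B [:P i - [:q $ i:], [:u $ i:]:]" for i
    using assms[of i] by (auto simp: coeff_deg_le_def coeff_pCons intro: degree_diff_le split: nat.split)
  have c: "coeff_deg_le 0 [:[:c:]:]" for c
    by (auto simp: coeff_deg_le_def coeff_pCons split: nat.split)
  show ?thesis unfolding along_curve_def Let_def coeff_sum
  proof (intro degree_sum_le finite_indices)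
    fix g assume "g \<in> indices n"
    then have "mdeg g * B \<le> n * B" by (simp add: indices_def)
    moreover have "degree (coeff ([:[:A g:]:] * mon [:P 1 - [:q $ 1:], [:u $ 1:]:]
        [:P 2 - [:q $ 2:], [:u $ 2:]:] [:P 3 - [:q $ 3:], [:u $ 3:]:] g) e) \<le> 0 + mdeg g * B"
      using coeff_deg_le_mult[OF c coeff_deg_le_mon[OF X X X]] unfolding coeff_deg_le_def by blast
    ultimately show "degree (coeff ([:[:A g:]:] * mon [:P 1 - [:q $ 1:], [:u $ 1:]:]
        [:P 2 - [:q $ 2:], [:u $ 2:]:] [:P 3 - [:q $ 3:], [:u $ 3:]:] g) e) \<le> n * B"
      by linarith
  qed
qed

lemma pcompose_power: "pcompose (p ^ m) r = pcompose p r ^ m"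
  by (induction m) (simp_all add: pcompose_mult pcompose_1)

lemma pcompose_mon: "pcompose (mon x y z g) r = mon (pcompose x r) (pcompose y r) (pcompose z r) g"
  by (cases g) (simp add: pcompose_mult pcompose_power)

text \<open>
  The substitution \<open>s = h ^ k s'\<close> makes \<open>P - q + s u\<close> divisible by \<open>h ^ k\<close>. If \<open>F\<close> vanishes to order \<open>v\<close>
  at \<open>q\<close>, the whole expansion is then divisible by \<open>h ^ (k * v)\<close>, and the quotient \<open>Y\<close> is explicit.
  The divisibility bounds orders of vanishing from below, and the value of \<open>Y\<close> at the zero of \<open>h\<close>
  identifies the lowest order term.
\<close>

lemma along_curve_rescaled:
  fixes A h k Q u v n
  defines "Y \<equiv> (let X = \<lambda>i. [:Q i, [:u $ i:]:] in
      \<Sum>g\<in>indices n. [:[:A g:] * h ^ (k * (mdeg g - v)):] * mon (X 1) (X 2) (X 3) g)"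
  assumes Q: "\<And>i. P i - [:q $ i:] = h ^ k * Q i"
    and A: "\<And>g. mdeg g < v \<Longrightarrow> A g = 0"
  shows "h ^ (k * e) * coeff (along_curve n A q P u) e = h ^ (k * v) * coeff Y e"
proof -
  define X where "X i = [:Q i, [:u $ i:]:]" for i
  have lin: "pcompose [:P i - [:q $ i:], [:u $ i:]:] [:0, h ^ k:] = [:h ^ k:] * X i" for i
    by (simp add: pcompose_pCons Q X_def)
  have "pcompose (along_curve n A q P u) [:0, h ^ k:] =
      (\<Sum>g\<in>indices n. [:[:A g:]:] * ([:h ^ k:] ^ mdeg g * mon (X 1) (X 2) (X 3) g))"
    unfolding along_curve_def Let_def pcompose_sum pcompose_mult pcompose_const pcompose_mon lin mon_scale ..
  also have "\<dots> = (\<Sum>g\<in>indices n. [:h ^ (k * v):] *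
      ([:[:A g:] * h ^ (k * (mdeg g - v)):] * mon (X 1) (X 2) (X 3) g))"
  proof (rule sum.cong)
    fix g
    show "[:[:A g:]:] * ([:h ^ k:] ^ mdeg g * mon (X 1) (X 2) (X 3) g) = [:h ^ (k * v):] *
      ([:[:A g:] * h ^ (k * (mdeg g - v)):] * mon (X 1) (X 2) (X 3) g)"
    proof (cases "mdeg g < v")
      case True
      then show ?thesis by (simp add: A)
    next
      case False
      then have "k * mdeg g = k * v + k * (mdeg g - v)" by (simp flip: distrib_left)
      then have "h ^ (k * mdeg g) = h ^ (k * v) * h ^ (k * (mdeg g - v))" by (simp add: power_add)
      then show ?thesis
        by (simp add: poly_const_pow mult_ac flip: power_mult)
    qed
  qed simp
  also have "\<dots> = smult (h ^ (k * v)) Y"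
    unfolding Y_def Let_def X_def sum_distrib_left[symmetric] by simp
  finally have "coeff (pcompose (along_curve n A q P u) [:0, h ^ k:]) e = coeff (smult (h ^ (k * v)) Y) e"
    by simp
  then show ?thesis by (simp add: coeff_pcompose_linear power_mult)
qed

text \<open>
  A derivative of order \<open>e\<close> lowers the order of vanishing at \<open>q\<close> by at most \<open>e\<close>.
\<close>

lemma along_curve_coeff_divisible:
  assumes t: "curve_pt P t = q" and A: "\<And>g. mdeg g < v \<Longrightarrow> A g = 0"
  shows "[:-t, 1:] ^ (v - e) dvd coeff (along_curve n A q P u) e"
proof (cases "e \<le> v")
  case True
  have "poly (P i - [:q $ i:]) t = 0" for i using t by (auto simp: curve_pt_def)
  then have "\<exists>Q. P i - [:q $ i:] = [:-t, 1:] ^ 1 * Q" for i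
    unfolding poly_eq_0_iff_dvd dvd_def power_one_right .
  then obtain Q where "\<And>i. P i - [:q $ i:] = [:-t, 1:] ^ 1 * Q i" by metis
  from along_curve_rescaled[where A = A and v = v, OF this A, where e = e and n = n and u = u] obtain y where
    "[:-t, 1:] ^ e * coeff (along_curve n A q P u) e = [:-t, 1:] ^ v * y" by auto
  also have "[:-t, 1:] ^ v = [:-t, 1:] ^ e * [:-t, 1:] ^ (v - e)"
    using True by (simp flip: power_add)
  finally have "coeff (along_curve n A q P u) e = [:-t, 1:] ^ (v - e) * y" by (simp add: mult.assoc)
  then show ?thesis by simp
qed simp

lemma poly_const_eq_poly_map_poly:
  "poly (poly Y [:s:]) t = poly (map_poly (\<lambda>c. poly c t) Y) (s::real)"
  by (induction Y) (simp_all add: map_poly_pCons)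

text \<open>
  The homogeneous part of degree \<open>v\<close>. It is the leading form if all coefficients below \<open>v\<close> vanish.
\<close>

definition leading :: "nat \<Rightarrow> (index \<Rightarrow> real) \<Rightarrow> real^3 \<Rightarrow> real" where
  "leading v A x = (\<Sum>g | mdeg g = v. A g * vmon x g)"

text \<open>
  Near a point where the curve leaves \<open>q\<close> in direction \<open>w\<close>, the lowest order term of
  \<open>F (P(t) + s u)\<close> under the above rescaling is the leading form of \<open>F\<close> at \<open>w + s u\<close>. A monomial
  \<open>s ^ e\<close> that occurs there cannot disappear from the whole expansion.
\<close>

lemma along_curve_coeff_nonzero:
  assumes k: "k > 0" and Q: "\<And>i. P i - [:q $ i:] = [:-t, 1:] ^ k * Q i" and w: "curve_pt Q t = w"
    and A: "\<And>g. mdeg g < v \<Longrightarrow> A g = 0" and v: "v \<le> n"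
    and \<pi>: "\<And>s. poly \<pi> s = leading v A (w + s *\<^sub>R u)" "coeff \<pi> e \<noteq> 0"
  shows "coeff (along_curve n A q P u) e \<noteq> 0"
proof
  assume 0: "coeff (along_curve n A q P u) e = 0"
  define Y where "Y = (let X = \<lambda>i. [:Q i, [:u $ i:]:] in
      \<Sum>g\<in>indices n. [:[:A g:] * [:-t, 1:] ^ (k * (mdeg g - v)):] * mon (X 1) (X 2) (X 3) g)"
  have "[:-t, 1:] ^ (k * v) * coeff Y e = 0"
    using along_curve_rescaled[where A = A and v = v, OF Q A, where e = e and n = n and u = u] 0 by (simp add: Y_def)
  then have "coeff Y e = 0" by simp
  have sub: "{g. mdeg g = v} \<subseteq> indices n" using v by (auto simp: indices_def)
  have "poly (poly Y [:s:]) t = leading v A (w + s *\<^sub>R u)" for s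
  proof -
    have "poly (poly Y [:s:]) t = (\<Sum>g\<in>indices n. A g * 0 ^ (k * (mdeg g - v)) * vmon (w + s *\<^sub>R u) g)"
      by (simp add: Y_def Let_def poly_sum curve_pt_def mult_ac flip: w)
    also have "\<dots> = leading v A (w + s *\<^sub>R u)" unfolding leading_def
    proof (rule sum.mono_neutral_cong_right[OF finite_indices sub])
      show "\<forall>g\<in>indices n - {g. mdeg g = v}. A g * 0 ^ (k * (mdeg g - v)) * vmon (w + s *\<^sub>R u) g = 0"
        using A k by (auto simp: not_less nat_neq_iff)
    qed auto
    finally show ?thesis .
  qed
  then have "\<pi> = map_poly (\<lambda>c. poly c t) Y"
    by (intro poly_ext) (simp add: \<pi>(1) flip: poly_const_eq_poly_map_poly)
  then have "coeff \<pi> e = poly (coeff Y e) t" by (simp add: coeff_map_poly)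
  with \<open>coeff Y e = 0\<close> \<pi>(2) show False by simp
qed

section \<open>Counting vanishing conditions\<close>

text \<open>
  The curve \<open>P\<close> passes through \<open>p\<close> at time \<open>t\<close> with lowest order term \<open>w\<close>, that is,
  \<open>P(t + h) = p + h ^ k w + O(h ^ (k + 1))\<close>. Cusps, where the derivative of \<open>P\<close> vanishes, are included.
\<close>

definition leads_at :: "(3 \<Rightarrow> real poly) \<Rightarrow> real^3 \<Rightarrow> real \<Rightarrow> real^3 \<Rightarrow> bool" where
  "leads_at P p t w \<longleftrightarrow>
     (\<exists>k Q. k > 0 \<and> (\<forall>i. P i - [:p $ i:] = [:-t, 1:] ^ k * Q i) \<and> curve_pt Q t = w)"

lemma finite_mdeg_eq: "finite {g. mdeg g = v}"
  by (rule finite_subset[OF _ finite_indices[of v]]) (auto simp: indices_def)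

lemma in_frame_surj:
  assumes "span {u, v, w} = UNIV"
  shows "\<exists>x y z. r = in_frame u v w x y z"
proof -
  have "r \<in> span {u, v, w}" using assms by simp
  then obtain x y z where "r - x *\<^sub>R u - y *\<^sub>R v - z *\<^sub>R w = 0"
    by (auto simp: span_breakdown_eq)
  then have "r = in_frame u v w x y z" by (simp add: in_frame_def algebra_simps)
  then show ?thesis by blast
qed

text \<open>
  The coefficients in a new frame depend linearly on the old ones: \<open>M\<close> is the matrix of this change,
  and it is what turns the vanishing of coefficients in a frame into linear conditions.
\<close>

lemma recentre:
  fixes q u v w
  shows "\<exists>M. \<forall>g\<in>indices n. \<forall>x y z.
    vmon (q + in_frame u v w x y z) g = (\<Sum>h\<in>indices n. M g h * mon x y z h)"
proof -
  have "\<forall>g. \<exists>M. g \<in> indices n \<longrightarrow>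
    (\<forall>x y z. vmon (q + in_frame u v w x y z) g = (\<Sum>h\<in>indices n. M h * mon x y z h))"
    using recentre_monomial unfolding polyfun3_def indices_def by auto
  then show ?thesis by metis
qed

lemma recentre_combination:
  assumes "\<forall>g\<in>indices n. \<forall>x y z.
    vmon (q + in_frame u v w x y z) g = (\<Sum>h\<in>indices n. M g h * mon x y z h)"
  shows "(\<Sum>g\<in>indices n. a g * vmon (q + in_frame u v w x y z) g) =
    (\<Sum>h\<in>indices n. (\<Sum>g\<in>indices n. M g h * a g) * mon x y z h)"
proof -
  have "(\<Sum>g\<in>indices n. a g * vmon (q + in_frame u v w x y z) g) =
    (\<Sum>g\<in>indices n. \<Sum>h\<in>indices n. a g * (M g h * mon x y z h))"
    using assms by (simp add: sum_distrib_left)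
  also have "\<dots> = (\<Sum>h\<in>indices n. \<Sum>g\<in>indices n. a g * (M g h * mon x y z h))"
    by (rule sum.swap)
  finally show ?thesis by (simp add: sum_distrib_left mult_ac)
qed

lemma in_frame_axis: "in_frame (axis 1 1) (axis 2 1) (axis 3 1) (x $ 1) (x $ 2) (x $ 3) = x"
  by (simp add: in_frame_def vec_eq_iff forall_3 axis_def)

lemma expansion_exists: "\<exists>A. expands n (\<lambda>x. \<Sum>g\<in>indices n. a g * vmon x g) q A"
proof -
  obtain M where M: "\<forall>g\<in>indices n. \<forall>x y z. vmon (q + in_frame (axis 1 1) (axis 2 1) (axis 3 1) x y z) g =
      (\<Sum>h\<in>indices n. M g h * mon x y z h)"
    using recentre by blast
  have "(\<Sum>g\<in>indices n. a g * vmon (q + x) g) =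
      (\<Sum>h\<in>indices n. (\<Sum>g\<in>indices n. M g h * a g) * vmon x h)" for x
    using recentre_combination[OF M, of a "x $ 1" "x $ 2" "x $ 3"] unfolding in_frame_axis .
  then show ?thesis unfolding expands_def
    by (intro exI[of _ "\<lambda>h. \<Sum>g\<in>indices n. M g h * a g"] allI)
qed

lemma leading_in_frame:
  assumes A: "expands n F q A" and v: "v \<le> n"
    and C: "\<And>x y z. F (q + in_frame w1 w2 w3 x y z) = (\<Sum>g\<in>indices n. C g * mon x y z g)"
  shows "leading v A (in_frame w1 w2 w3 x y z) = (\<Sum>g | mdeg g = v. C g * mon x y z g)"
proof -
  let ?X = "in_frame w1 w2 w3 x y z"
  have "(\<Sum>g\<in>indices n. (A g * vmon ?X g - C g * mon x y z g) * s ^ mdeg g) = 0" for s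
  proof -
    have X: "s *\<^sub>R ?X = in_frame w1 w2 w3 (s * x) (s * y) (s * z)"
      by (simp add: in_frame_def algebra_simps)
    have "(\<Sum>g\<in>indices n. A g * vmon (s *\<^sub>R ?X) g) = F (q + s *\<^sub>R ?X)"
      using A unfolding expands_def by (simp only:)
    also have "\<dots> = F (q + in_frame w1 w2 w3 (s * x) (s * y) (s * z))" by (simp only: X)
    also have "\<dots> = (\<Sum>g\<in>indices n. C g * mon (s * x) (s * y) (s * z) g)" by (rule C)
    finally have "(\<Sum>g\<in>indices n. A g * vmon (s *\<^sub>R ?X) g) =
        (\<Sum>g\<in>indices n. C g * mon (s * x) (s * y) (s * z) g)" .
    then show ?thesis by (simp add: mon_scale algebra_simps sum_subtractf)
  qed
  from sum_of_powers_eq_0_imp_graded_part_eq_0[OF finite_indices this]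
  have "(\<Sum>g | g \<in> indices n \<and> mdeg g = v. A g * vmon ?X g - C g * mon x y z g) = 0" .
  moreover have "{g. g \<in> indices n \<and> mdeg g = v} = {g. mdeg g = v}"
    using v by (auto simp: indices_def)
  ultimately show ?thesis by (simp add: leading_def sum_subtractf)
qed

text \<open>
  If \<open>x ^ i y ^ j z ^ k\<close> occurs in a form of degree \<open>v\<close>, then the coefficient of \<open>x ^ i\<close>, a form in \<open>y\<close> and
  \<open>z\<close>, is non-zero at some direction \<open>u\<close>. Along \<open>w1 + s u\<close> that coefficient is seen as the one of \<open>s ^ (v - i)\<close>.
\<close>

lemma direction_detecting_exponent:
  assumes lead: "\<And>x y z. f (in_frame w1 w2 w3 x y z) = (\<Sum>g | mdeg g = v. C g * mon x y z g)"
    and C: "C (i, j, k) \<noteq> 0" and v: "i + j + k = v"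
  shows "\<exists>u \<pi>. (\<forall>s. poly \<pi> s = f (w1 + s *\<^sub>R u)) \<and> coeff \<pi> (v - i) \<noteq> 0"
proof -
  let ?S = "{g. mdeg g = v}" and ?Si = "{g. mdeg g = v \<and> fst g = i}"
  define \<rho> where "\<rho> = (\<Sum>g\<in>?Si. monom (C g) (fst (snd g)))"
  have finSi: "finite ?Si" by (rule finite_subset[OF _ finite_mdeg_eq[of v]]) auto
  have "coeff \<rho> j = (\<Sum>g\<in>?Si. if g = (i, j, k) then C g else 0)"
    unfolding \<rho>_def coeff_sum by (intro sum.cong) (use v in auto)
  also have "\<dots> = C (i, j, k)" using v finSi by (subst sum.delta) auto
  finally have "\<rho> \<noteq> 0" using C by auto
  then have "\<not> (\<forall>y. poly \<rho> y = 0)" by (simp add: poly_all_0_iff_0)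
  then obtain y where y: "poly \<rho> y \<noteq> 0" by blast
  define \<pi> where "\<pi> = (\<Sum>g\<in>?S. monom (C g * y ^ fst (snd g)) (v - fst g))"
  have "poly \<pi> s = f (w1 + s *\<^sub>R (y *\<^sub>R w2 + w3))" for s
  proof -
    have "w1 + s *\<^sub>R (y *\<^sub>R w2 + w3) = in_frame w1 w2 w3 1 (s * y) s"
      by (simp add: in_frame_def algebra_simps)
    then have "f (w1 + s *\<^sub>R (y *\<^sub>R w2 + w3)) = (\<Sum>g\<in>?S. C g * mon 1 (s * y) s g)"
      using lead by simp
    also have "\<dots> = (\<Sum>g\<in>?S. C g * y ^ fst (snd g) * s ^ (v - fst g))"
    proof (rule sum.cong)
      fix g assume "g \<in> ?S"
      then show "C g * mon 1 (s * y) s g = C g * y ^ fst (snd g) * s ^ (v - fst g)"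
        by (cases g) (auto simp: power_mult_distrib power_add)
    qed simp
    finally show ?thesis by (simp add: \<pi>_def poly_sum poly_monom)
  qed
  moreover have "coeff \<pi> (v - i) = poly \<rho> y"
  proof -
    have "coeff \<pi> (v - i) = (\<Sum>g\<in>?S. if fst g = i then C g * y ^ fst (snd g) else 0)"
      unfolding \<pi>_def coeff_sum by (intro sum.cong) (use v in auto)
    also have "\<dots> = (\<Sum>g\<in>?Si. C g * y ^ fst (snd g))"
      by (subst sum.inter_filter[OF finite_mdeg_eq, symmetric]) simp
    finally show ?thesis by (simp add: \<rho>_def poly_sum poly_monom)
  qed
  ultimately show ?thesis using y by metis
qed

text \<open>
  The derivative of \<open>F\<close> of order \<open>e\<close> in direction \<open>u\<close> is a non-zero polynomial along the curve, so the
  number of its zeros, with multiplicities, is at most its degree. That curves are parametrised by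
  polynomials makes this elementary.
\<close>

lemma vanishing_orders_le_degree:
  assumes deg: "\<And>i. degree (P i) \<le> B" and fin: "finite Q"
    and on: "\<And>q. q \<in> Q \<Longrightarrow> q \<in> range (curve_pt P)"
    and A: "\<And>q. expands n F q (A q)" "\<And>q g. mdeg g < v q \<Longrightarrow> A q g = 0"
    and p: "leads_at P p t w" "v p \<le> n"
    and \<pi>: "\<And>s. poly \<pi> s = leading (v p) (A p) (w + s *\<^sub>R u)" "coeff \<pi> e \<noteq> 0"
  shows "(\<Sum>q\<in>Q. v q - e) \<le> n * B"
proof -
  define f where "f = coeff (along_curve n (A p) p P u) e"
  obtain k R where R: "k > 0" "\<And>i. P i - [:p $ i:] = [:-t, 1:] ^ k * R i" "curve_pt R t = w"
    using p(1) unfolding leads_at_def by blast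
  have f: "f \<noteq> 0" unfolding f_def
    by (rule along_curve_coeff_nonzero[where A = "A p" and v = "v p", OF R A(2) p(2) \<pi>])
  obtain \<tau> where \<tau>: "\<And>q. q \<in> Q \<Longrightarrow> curve_pt P (\<tau> q) = q" proof -
    have "\<forall>q\<in>Q. \<exists>t. curve_pt P t = q" using on by (auto simp: image_iff)
    then show thesis using that by metis
  qed
  have inj: "inj_on \<tau> Q" by (rule inj_on_inverseI[of Q "curve_pt P"]) (rule \<tau>)
  have ord: "v q - e \<le> order (\<tau> q) f" if "q \<in> Q" for q
  proof -
    have "[:-\<tau> q, 1:] ^ (v q - e) dvd coeff (along_curve n (A q) q P u) e"
      by (rule along_curve_coeff_divisible) (use \<tau> that A(2) in auto)
    also have "along_curve n (A q) q P u = along_curve n (A p) p P u"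
      by (rule along_curve_independent_of_centre) (rule A)+
    finally show ?thesis using f by (simp add: f_def order_divides)
  qed
  let ?R = "{x. poly f x = 0}"
  have "(\<Sum>q\<in>Q. v q - e) \<le> (\<Sum>q\<in>Q. order (\<tau> q) f)" using ord by (rule sum_mono)
  also have "\<dots> = (\<Sum>x\<in>\<tau> ` Q. order x f)" by (simp add: sum.reindex[OF inj])
  also have "\<dots> = (\<Sum>x\<in>\<tau> ` Q \<inter> ?R. order x f)"
    using fin by (intro sum.mono_neutral_right) (auto simp: order_0I)
  also have "\<dots> \<le> (\<Sum>x\<in>?R. order x f)"
    by (intro sum_mono2 poly_roots_finite f) auto
  also have "\<dots> \<le> degree f" by (rule sum_order_le_degree[OF f])
  also have "\<dots> \<le> n * B" unfolding f_def by (rule degree_coeff_along_curve[OF deg])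
  finally show ?thesis .
qed

definition spanning_triple :: "('c \<Rightarrow> 3 \<Rightarrow> real poly) \<Rightarrow> real^3 \<Rightarrow> 'c \<Rightarrow> 'c \<Rightarrow> 'c \<Rightarrow> bool" where
  "spanning_triple cv p c1 c2 c3 \<longleftrightarrow> (\<exists>t1 t2 t3 w1 w2 w3. leads_at (cv c1) p t1 w1 \<and>
     leads_at (cv c2) p t2 w2 \<and> leads_at (cv c3) p t3 w3 \<and> span {w1, w2, w3} = UNIV)"

lemma leads_at_imp_curve_pt:
  assumes "leads_at P p t w" shows "curve_pt P t = p"
proof -
  obtain k Q where "k > 0" "\<And>i. P i - [:p $ i:] = [:-t, 1:] ^ k * Q i"
    using assms unfolding leads_at_def by blast
  then have "poly (P i - [:p $ i:]) t = 0" for i by simp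
  then show ?thesis by (simp add: curve_pt_def vec_eq_iff)
qed

text \<open>
  Suppose that the number of box conditions below is smaller than the dimension of the space of
  polynomials of degree at most \<open>n\<close>. Some \<open>F \<noteq> 0\<close> then has, at each \<open>p\<close> and in the frame of its three
  directions, no monomial in the box with side lengths \<open>k c - \<delta> p\<close>. Take \<open>p\<close> that minimises
  \<open>v p + \<delta> p\<close>, with \<open>v p\<close> the order of vanishing at \<open>p\<close>, and a monomial of lowest degree there. It is outside the box, so one of its
  exponents \<open>i\<close> has \<open>i \<ge> k c - \<delta> p\<close> for the corresponding curve \<open>c\<close>. Differentiate \<open>v p - i\<close> times
  transversally to \<open>c\<close>. By the choice of \<open>p\<close>, the result vanishes at each \<open>q\<close> on \<open>c\<close> to order at least
  \<open>v q - (v p - i) \<ge> i + \<delta> p - \<delta> q \<ge> k c - \<delta> q\<close>, and these orders add up to at least \<open>D\<close>, which is too much.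
\<close>

lemma dimension_count:
  fixes cv :: "'c \<Rightarrow> 3 \<Rightarrow> real poly" and \<delta> :: "real^3 \<Rightarrow> nat" and k :: "'c \<Rightarrow> nat"
  assumes U: "finite U" "U \<noteq> {}" and D: "n * B < D"
    and deg: "\<And>c i. c \<in> C \<Longrightarrow> degree (cv c i) \<le> B"
    and T: "\<And>p. p \<in> U \<Longrightarrow> spanning_triple cv p (T1 p) (T2 p) (T3 p)"
      "\<And>p. p \<in> U \<Longrightarrow> T1 p \<in> C \<and> T2 p \<in> C \<and> T3 p \<in> C"
    and level: "\<And>c. c \<in> C \<Longrightarrow> U \<inter> range (curve_pt (cv c)) \<noteq> {} \<Longrightarrow>
      D \<le> (\<Sum>p\<in>U \<inter> range (curve_pt (cv c)). k c - \<delta> p)"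
  shows "card (indices n) \<le> (\<Sum>p\<in>U. (k (T1 p) - \<delta> p) * (k (T2 p) - \<delta> p) * (k (T3 p) - \<delta> p))"
proof (rule ccontr)
  assume less: "\<not> ?thesis"
  obtain t1 t2 t3 w1 w2 w3 where w: "\<And>p. p \<in> U \<Longrightarrow> leads_at (cv (T1 p)) p (t1 p) (w1 p) \<and>
      leads_at (cv (T2 p)) p (t2 p) (w2 p) \<and> leads_at (cv (T3 p)) p (t3 p) (w3 p) \<and> span {w1 p, w2 p, w3 p} = UNIV"
    using T(1) unfolding spanning_triple_def by metis
  define box where "box p = {..<k (T1 p) - \<delta> p} \<times> {..<k (T2 p) - \<delta> p} \<times> {..<k (T3 p) - \<delta> p}" for p
  have "\<forall>p. \<exists>M. \<forall>g\<in>indices n. \<forall>x y z. vmon (p + in_frame (w1 p) (w2 p) (w3 p) x y z) g =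
      (\<Sum>h\<in>indices n. M g h * mon x y z h)"
    using recentre by blast
  from choice[OF this] obtain M where M: "\<forall>p. \<forall>g\<in>indices n. \<forall>x y z.
      vmon (p + in_frame (w1 p) (w2 p) (w3 p) x y z) g = (\<Sum>h\<in>indices n. M p g h * mon x y z h)"
    by (rule exE)
  have "card (SIGMA p:U. box p) < card (indices n)"
    using less U(1) by (simp add: box_def card_cartesian_product mult.assoc)
  moreover have "finite (SIGMA p:U. box p)" using U(1) by (simp add: box_def)
  ultimately obtain a where a: "\<exists>g\<in>indices n. a g \<noteq> 0"
      "\<forall>(p, h)\<in>(SIGMA p:U. box p). (\<Sum>g\<in>indices n. M p g h * a g) = 0"
    using underdetermined_system_has_solution[of "SIGMA p:U. box p" "indices n" "\<lambda>(p, h) g. M p g h"] finite_indices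
    by (auto simp: case_prod_unfold)
  define F where "F = (\<lambda>x. \<Sum>g\<in>indices n. a g * vmon x g)"
  have "\<forall>p. \<exists>A. expands n F p A"
    unfolding F_def by (intro allI expansion_exists)
  from choice[OF this] obtain A where "\<forall>p. expands n F p (A p)" by (rule exE)
  then have A: "expands n F p (A p)" for p by (rule spec)
  have nz: "\<exists>g\<in>indices n. A p g \<noteq> 0" for p
  proof (rule ccontr)
    assume "\<not> ?thesis"
    then have "F (p + x) = 0" for x using A[of p] by (simp add: expands_def)
    from this[of "_ - p"] have "F x = 0" for x by simp
    from this[of "vector [_, _, _]"] have "(\<Sum>g\<in>indices n. a g * mon x y z g) = 0" for x y z
      by (simp add: F_def)
    from coeffs_eq_0_if_vanishing[OF finite_indices this] a(1) show False by blast
  qed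
  define v where "v p = (LEAST m. \<exists>g\<in>indices n. mdeg g = m \<and> A p g \<noteq> 0)" for p
  have v: "\<exists>g\<in>indices n. mdeg g = v p \<and> A p g \<noteq> 0" for p
    unfolding v_def by (rule LeastI_ex) (use nz[of p] in blast)
  have vn: "v p \<le> n" for p using v[of p] by (auto simp: indices_def)
  have below: "A p g = 0" if "mdeg g < v p" for p g
  proof (rule ccontr)
    assume "A p g \<noteq> 0"
    moreover have "g \<in> indices n" using that vn[of p] by (simp add: indices_def)
    ultimately have "v p \<le> mdeg g" unfolding v_def by (intro Least_le) blast
    with that show False by simp
  qed
  obtain p where p: "p \<in> U" "\<And>q. q \<in> U \<Longrightarrow> v p + \<delta> p \<le> v q + \<delta> q"
    using arg_min_if_finite(1)[OF U, of "\<lambda>q. v q + \<delta> q"] arg_min_least[OF U, of _ "\<lambda>q. v q + \<delta> q"] by blast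
  define E where "E h = (\<Sum>g\<in>indices n. M p g h * a g)" for h
  have E: "F (p + in_frame (w1 p) (w2 p) (w3 p) x y z) = (\<Sum>h\<in>indices n. E h * mon x y z h)" for x y z
    unfolding F_def E_def by (rule recentre_combination[OF spec[OF M]])
  note lead = leading_in_frame[OF A[of p] vn[of p] E]
  have "\<exists>h. mdeg h = v p \<and> E h \<noteq> 0"
  proof (rule ccontr)
    assume "\<not> ?thesis"
    then have "leading (v p) (A p) (in_frame (w1 p) (w2 p) (w3 p) x y z) = 0" for x y z
      unfolding lead by (intro sum.neutral) auto
    then have "leading (v p) (A p) r = 0" for r
      using in_frame_surj[of "w1 p" "w2 p" "w3 p" r] w[OF p(1)] by metis
    from this[of "vector [_, _, _]"] have "(\<Sum>g | mdeg g = v p. A p g * mon x y z g) = 0" for x y z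
      by (simp add: leading_def)
    from coeffs_eq_0_if_vanishing[OF finite_mdeg_eq this] v[of p] show False by blast
  qed
  then obtain i1 i2 i3 where i: "i1 + i2 + i3 = v p" "E (i1, i2, i3) \<noteq> 0" by auto
  have "(i1, i2, i3) \<notin> box p" using a(2) p(1) i(2) by (auto simp: E_def)
  \<comment> \<open>One exponent outside the box is contradictory; by symmetry of the three directions it does not
     matter which one.\<close>
  have key: False if c: "c \<in> C" "leads_at (cv c) p t w" and i_ge: "i \<ge> k c - \<delta> p" "i \<le> v p"
    and ex: "\<exists>u \<pi>. (\<forall>s. poly \<pi> s = leading (v p) (A p) (w + s *\<^sub>R u)) \<and> coeff \<pi> (v p - i) \<noteq> 0" for c t w i
  proof -
    let ?Q = "U \<inter> range (curve_pt (cv c))"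
    have "p \<in> ?Q" using p(1) leads_at_imp_curve_pt[OF c(2)] by blast
    then have "D \<le> (\<Sum>q\<in>?Q. k c - \<delta> q)" using level[OF c(1)] by blast
    also have "\<dots> \<le> (\<Sum>q\<in>?Q. v q - (v p - i))"
    proof (rule sum_mono)
      fix q assume "q \<in> ?Q"
      then have "v p + \<delta> p \<le> v q + \<delta> q" using p(2) by blast
      then show "k c - \<delta> q \<le> v q - (v p - i)" using i_ge by linarith
    qed
    also have "\<dots> \<le> n * B"
      using ex by (elim exE conjE) (rule vanishing_orders_le_degree[OF deg[OF c(1)] _ _ A below c(2) vn],
          use U in auto)
    finally show False using D by simp
  qed
  consider "i1 \<ge> k (T1 p) - \<delta> p" | "i2 \<ge> k (T2 p) - \<delta> p" | "i3 \<ge> k (T3 p) - \<delta> p"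
    using \<open>(i1, i2, i3) \<notin> box p\<close> by (auto simp: box_def not_less)
  then show False
  proof cases
    case 1
    show False
      by (rule key[OF _ _ 1 _ direction_detecting_exponent[of _ _ "w2 p" "w3 p", OF lead i(2,1)]])
         (use T(2) w p(1) i(1) in auto)
  next
    \<comment> \<open>The frame with its first two vectors exchanged brings the exponent to the first position.\<close>
    case 2
    have "leading (v p) (A p) (in_frame (w2 p) (w1 p) (w3 p) x y z) =
        (\<Sum>g | mdeg g = v p. E (fst (snd g), fst g, snd (snd g)) * mon x y z g)" for x y z
    proof -
      have "leading (v p) (A p) (in_frame (w2 p) (w1 p) (w3 p) x y z) =
          leading (v p) (A p) (in_frame (w1 p) (w2 p) (w3 p) y x z)" by (simp add: in_frame_def add_ac)
      also have "\<dots> = (\<Sum>g | mdeg g = v p. E g * mon y x z g)" by (rule lead)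
      also have "\<dots> = (\<Sum>g | mdeg g = v p. E (fst (snd g), fst g, snd (snd g)) * mon x y z g)"
        by (rule sum.reindex_bij_witness[of _ "\<lambda>g. (fst (snd g), fst g, snd (snd g))" "\<lambda>g. (fst (snd g), fst g, snd (snd g))"])
           (auto simp: mult_ac)
      finally show ?thesis .
    qed
    from direction_detecting_exponent[OF this, of i2 i1 i3] i
    have "\<exists>u \<pi>. (\<forall>s. poly \<pi> s = leading (v p) (A p) (w2 p + s *\<^sub>R u)) \<and> coeff \<pi> (v p - i2) \<noteq> 0" by simp
    then show False by (intro key[OF _ _ 2]) (use T(2) w p(1) i(1) in auto)
  next
    case 3
    have "leading (v p) (A p) (in_frame (w3 p) (w2 p) (w1 p) x y z) =
        (\<Sum>g | mdeg g = v p. E (snd (snd g), fst (snd g), fst g) * mon x y z g)" for x y z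
    proof -
      have "leading (v p) (A p) (in_frame (w3 p) (w2 p) (w1 p) x y z) =
          leading (v p) (A p) (in_frame (w1 p) (w2 p) (w3 p) z y x)" by (simp add: in_frame_def add_ac)
      also have "\<dots> = (\<Sum>g | mdeg g = v p. E g * mon z y x g)" by (rule lead)
      also have "\<dots> = (\<Sum>g | mdeg g = v p. E (snd (snd g), fst (snd g), fst g) * mon x y z g)"
        by (rule sum.reindex_bij_witness[of _ "\<lambda>g. (snd (snd g), fst (snd g), fst g)" "\<lambda>g. (snd (snd g), fst (snd g), fst g)"])
           (auto simp: mult_ac)
      finally show ?thesis .
    qed
    from direction_detecting_exponent[OF this, of i3 i2 i1] i
    have "\<exists>u \<pi>. (\<forall>s. poly \<pi> s = leading (v p) (A p) (w3 p + s *\<^sub>R u)) \<and> coeff \<pi> (v p - i3) \<noteq> 0" by simp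
    then show False by (intro key[OF _ _ 3]) (use T(2) w p(1) i(1) in auto)
  qed
qed

section \<open>Balancing the weights\<close>

text \<open>
  Think of the points of \<open>c\<close> as columns with floors at heights \<open>\<delta> p\<close>. This is the level that the water
  reaches when at least \<open>D\<close> units are poured on \<open>c\<close>; the depth at \<open>p\<close> is the truncated difference
  \<open>water_level On D \<delta> c - \<delta> p\<close>.
\<close>

definition water_level :: "('c \<Rightarrow> 'p set) \<Rightarrow> nat \<Rightarrow> ('p \<Rightarrow> nat) \<Rightarrow> 'c \<Rightarrow> nat" where
  "water_level On D \<delta> c = (LEAST k. D \<le> (\<Sum>p\<in>On c. k - \<delta> p))"

lemma water_level_least: "D \<le> (\<Sum>p\<in>On c. k - \<delta> p) \<Longrightarrow> water_level On D \<delta> c \<le> k"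
  unfolding water_level_def by (rule Least_le)

lemma water_level_le:
  assumes "finite (On c)" "p \<in> On c"
  shows "water_level On D \<delta> c \<le> \<delta> p + D"
proof (rule water_level_least)
  have "\<delta> p + D - \<delta> p \<le> (\<Sum>p'\<in>On c. \<delta> p + D - \<delta> p')"
    by (rule member_le_sum[OF assms(2) _ assms(1)]) simp
  then show "D \<le> (\<Sum>p'\<in>On c. \<delta> p + D - \<delta> p')" by simp
qed

lemma water_level_sum:
  assumes "finite (On c)" "p \<in> On c"
  shows "D \<le> (\<Sum>p\<in>On c. water_level On D \<delta> c - \<delta> p)"
proof -
  have "\<delta> p + D - \<delta> p \<le> (\<Sum>p'\<in>On c. \<delta> p + D - \<delta> p')"
    by (rule member_le_sum[OF assms(2) _ assms(1)]) simp
  then have "D \<le> (\<Sum>p'\<in>On c. \<delta> p + D - \<delta> p')" by simp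
  then show ?thesis unfolding water_level_def by (rule LeastI)
qed

lemma water_level_sum_le: "(\<Sum>p\<in>On c. water_level On D \<delta> c - \<delta> p) \<le> D + card (On c)"
proof (cases "water_level On D \<delta> c")
  case (Suc k)
  have "\<not> D \<le> (\<Sum>p\<in>On c. k - \<delta> p)"
    using Suc not_less_Least[of k "\<lambda>k. D \<le> (\<Sum>p\<in>On c. k - \<delta> p)"] by (simp add: water_level_def)
  moreover have "(\<Sum>p\<in>On c. Suc k - \<delta> p) \<le> (\<Sum>p\<in>On c. (k - \<delta> p) + 1)"
    by (intro sum_mono) simp
  ultimately show ?thesis by (simp only: Suc sum.distrib) simp
qed simp

lemma water_level_mono:
  assumes "finite (On c)" "On c \<noteq> {}" "\<And>p. \<delta>' p \<le> \<delta> p"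
  shows "water_level On D \<delta>' c \<le> water_level On D \<delta> c"
proof (rule water_level_least)
  obtain p where "p \<in> On c" using assms(2) by blast
  from water_level_sum[where On = On, OF assms(1) this, of D \<delta>]
  show "D \<le> (\<Sum>p\<in>On c. water_level On D \<delta> c - \<delta>' p)"
    by (rule order_trans) (intro sum_mono diff_le_mono2 assms(3))
qed

text \<open>
  Pigeonhole: there are \<open>card J + 1\<close> disjoint blocks of length \<open>D\<close> and only \<open>card J\<close> heights.
\<close>

lemma gap_in_heights:
  fixes \<delta> :: "'p \<Rightarrow> nat"
  assumes "finite J" "D > 0"
  shows "\<exists>y. y \<le> card J * D \<and> (\<forall>q\<in>J. \<delta> q \<le> y \<or> y + D \<le> \<delta> q)"
proof -
  have "\<not> {..card J} \<subseteq> (\<lambda>q. (\<delta> q - 1) div D) ` J"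
    using card_mono[of "(\<lambda>q. (\<delta> q - 1) div D) ` J" "{..card J}"] card_image_le[OF assms(1), of "\<lambda>q. (\<delta> q - 1) div D"] assms(1) by fastforce
  \<comment> \<open>The height \<open>d > 0\<close> lies in block number \<open>(d - 1) div D\<close>, the interval \<open>{i * D <.. (i + 1) * D}\<close>.\<close>
  then obtain i where i: "i \<le> card J" "\<And>q. q \<in> J \<Longrightarrow> (\<delta> q - 1) div D \<noteq> i" by blast
  have "\<delta> q \<le> i * D \<or> i * D + D \<le> \<delta> q" if "q \<in> J" for q
  proof (rule disjCI)
    assume "\<not> i * D + D \<le> \<delta> q"
    then have "\<delta> q - 1 < Suc i * D" using assms(2) by simp
    then have "(\<delta> q - 1) div D < Suc i" using assms(2) by (simp add: div_less_iff_less_mult)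
    then have "(\<delta> q - 1) div D < i" using i(2)[OF that] by simp
    then have "\<delta> q - 1 < i * D" using assms(2) by (simp add: div_less_iff_less_mult)
    then show "\<delta> q \<le> i * D" by simp
  qed
  then show ?thesis using i(1) by (intro exI[of _ "i * D"]) auto
qed

text \<open>
  A counting inequality valid for all floor heights \<open>\<delta>\<close> yields weights that are large at every point
  simultaneously, in any prescribed proportion \<open>\<tau>\<close>. Lowering the floor of a point increases the depths
  there and decreases those at all other points. Starting from a high plateau, lower floors as long as
  every point that was lowered still has a triple with product at most \<open>\<tau>\<close>. In a minimal
  configuration, one more step at any point makes all products there exceed \<open>\<tau>\<close>, and that step increases
  depths by at most one. The step is possible unless some floor has reached \<open>0\<close>. In that case the
  heights have a gap of size \<open>D\<close>; curves that meet the low part \<open>U\<close> have water only in \<open>U\<close>, and the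
  counting inequality for \<open>U\<close> contradicts the small products.
\<close>

lemma balanced_weights:
  fixes On :: "'c \<Rightarrow> 'p set" and Tr :: "'p \<Rightarrow> ('c \<times> 'c \<times> 'c) set" and \<tau> :: "'p \<Rightarrow> real"
  assumes J: "finite J" and On: "\<And>c. On c \<subseteq> J" and D: "D > 0"
    and Tr: "\<And>p c1 c2 c3. p \<in> J \<Longrightarrow> (c1, c2, c3) \<in> Tr p \<Longrightarrow> p \<in> On c1 \<and> p \<in> On c2 \<and> p \<in> On c3"
    and \<tau>: "\<And>p. p \<in> J \<Longrightarrow> \<tau> p \<ge> 0" "(\<Sum>p\<in>J. \<tau> p) < real K"
    and count: "\<And>U \<delta> k T1 T2 T3. U \<subseteq> J \<Longrightarrow> U \<noteq> {} \<Longrightarrow>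
      (\<And>p. p \<in> U \<Longrightarrow> (T1 p, T2 p, T3 p) \<in> Tr p) \<Longrightarrow>
      (\<And>c. U \<inter> On c \<noteq> {} \<Longrightarrow> D \<le> (\<Sum>p\<in>U \<inter> On c. k c - \<delta> p)) \<Longrightarrow>
      K \<le> (\<Sum>p\<in>U. (k (T1 p) - \<delta> p) * (k (T2 p) - \<delta> p) * (k (T3 p) - \<delta> p))"
  shows "\<exists>b :: 'p \<Rightarrow> 'c \<Rightarrow> nat. (\<forall>c. (\<Sum>p\<in>On c. b p c) \<le> D + 2 * card J) \<and>
    (\<forall>p\<in>J. \<forall>(c1, c2, c3)\<in>Tr p. \<tau> p \<le> real (b p c1 * b p c2 * b p c3))"
proof -
  define M where "M = (card J + 1) * D"
  define lev where "lev = water_level On D"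
  define W where "W \<delta> p = (\<lambda>(c1, c2, c3). (lev \<delta> c1 - \<delta> p) * (lev \<delta> c2 - \<delta> p) * (lev \<delta> c3 - \<delta> p))"
    for \<delta> p
  \<comment> \<open>Points at the initial height \<open>M\<close> are unrestricted; all lowered points have a small product.\<close>
  define ok where "ok \<delta> \<longleftrightarrow> (\<forall>p\<in>J. \<delta> p \<le> M \<and> (\<delta> p < M \<longrightarrow> (\<exists>T\<in>Tr p. real (W \<delta> p T) \<le> \<tau> p)))" for \<delta>
  have finOn: "finite (On c)" for c using finite_subset[OF On J] .
  have "ok (\<lambda>_. M)" by (simp add: ok_def)
  then obtain \<delta> where \<delta>: "ok \<delta>" "\<And>\<delta>'. ok \<delta>' \<Longrightarrow> sum \<delta> J \<le> sum \<delta>' J"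
    using ex_has_least_nat[of ok "\<lambda>_. M" "\<lambda>\<delta>. sum \<delta> J"] by blast
  have pos: "\<delta> p0 > 0" if p0: "p0 \<in> J" for p0
  proof (rule ccontr)
    assume "\<not> \<delta> p0 > 0"
    obtain y where y: "y \<le> card J * D" "\<And>q. q \<in> J \<Longrightarrow> \<delta> q \<le> y \<or> y + D \<le> \<delta> q"
      using gap_in_heights[OF J D] by blast
    have yM: "y < M" using y(1) D by (simp add: M_def)
    define U where "U = {q\<in>J. \<delta> q \<le> y}"
    have "\<forall>p. \<exists>T. p \<in> U \<longrightarrow> T \<in> Tr p \<and> real (W \<delta> p T) \<le> \<tau> p"
      using \<delta>(1) yM unfolding ok_def U_def by fastforce
    then obtain T where T: "\<And>p. p \<in> U \<Longrightarrow> T p \<in> Tr p \<and> real (W \<delta> p (T p)) \<le> \<tau> p" by metis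
    have "K \<le> (\<Sum>p\<in>U. (lev \<delta> (fst (T p)) - \<delta> p) * (lev \<delta> (fst (snd (T p))) - \<delta> p) *
        (lev \<delta> (snd (snd (T p))) - \<delta> p))"
    proof (rule count)
      fix c assume "U \<inter> On c \<noteq> {}"
      then obtain p where p: "p \<in> On c" "\<delta> p \<le> y" by (auto simp: U_def)
      have "lev \<delta> c \<le> y + D"
        unfolding lev_def using water_level_le[where On = On and D = D and \<delta> = \<delta>, OF finOn p(1)] p(2) by simp
      have "D \<le> (\<Sum>p\<in>On c. lev \<delta> c - \<delta> p)" unfolding lev_def by (rule water_level_sum[where On = On, OF finOn p(1)])
      also have "\<dots> = (\<Sum>p\<in>U \<inter> On c. lev \<delta> c - \<delta> p)"
      proof (rule sum.mono_neutral_right[OF finOn])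
        show "\<forall>q\<in>On c - U \<inter> On c. lev \<delta> c - \<delta> q = 0"
          using On y(2) \<open>lev \<delta> c \<le> y + D\<close> unfolding U_def by fastforce
      qed auto
      finally show "D \<le> (\<Sum>p\<in>U \<inter> On c. lev \<delta> c - \<delta> p)" .
    qed (use T p0 \<open>\<not> \<delta> p0 > 0\<close> in \<open>auto simp: U_def\<close>)
    also have "\<dots> = (\<Sum>p\<in>U. W \<delta> p (T p))" by (simp add: W_def case_prod_unfold)
    finally have "real K \<le> (\<Sum>p\<in>U. real (W \<delta> p (T p)))"
      using of_nat_mono by fastforce
    also have "\<dots> \<le> (\<Sum>p\<in>U. \<tau> p)" using T by (intro sum_mono) blast
    also have "\<dots> \<le> (\<Sum>p\<in>J. \<tau> p)"
      using J \<tau>(1) by (intro sum_mono2) (auto simp: U_def)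
    finally show False using \<tau>(2) by simp
  qed
  \<comment> \<open>The depth after one more step at \<open>p\<close> is at most the present depth plus one.\<close>
  define b where "b p c = lev \<delta> c - \<delta> p + 1" for p c
  have "(\<Sum>p\<in>On c. b p c) \<le> D + 2 * card J" for c
    using water_level_sum_le[of On D \<delta> c] card_mono[OF J On[of c]]
    unfolding b_def lev_def sum.distrib by simp
  moreover have "\<tau> p \<le> real (b p c1 * b p c2 * b p c3)" if p: "p \<in> J" and T: "(c1, c2, c3) \<in> Tr p" for p c1 c2 c3
  proof -
    define \<delta>' where "\<delta>' = \<delta>(p := \<delta> p - 1)"
    have "sum \<delta>' J < sum \<delta> J"
      by (rule sum_strict_mono_ex1[OF J]) (use p pos[OF p] in \<open>auto simp: \<delta>'_def\<close>)
    then have "\<not> ok \<delta>'" using \<delta>(2) by (metis not_le)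
    then obtain q where q: "q \<in> J" "\<not> (\<delta>' q \<le> M \<and> (\<delta>' q < M \<longrightarrow> (\<exists>T\<in>Tr q. real (W \<delta>' q T) \<le> \<tau> q)))"
      unfolding ok_def by blast
    have "\<delta>' q \<le> M" using \<delta>(1) q(1) unfolding ok_def \<delta>'_def by (auto simp: le_diff_conv2 intro: le_trans)
    then have q': "\<delta>' q < M" "\<And>T. T \<in> Tr q \<Longrightarrow> \<tau> q < real (W \<delta>' q T)" using q(2) by force+
    have lev: "lev \<delta>' c \<le> lev \<delta> c" if "p' \<in> On c" for c p'
      unfolding lev_def by (rule water_level_mono[where On = On, OF finOn]) (use that in \<open>auto simp: \<delta>'_def\<close>)
    have "q = p"
    proof (rule ccontr)
      assume "q \<noteq> p"
      then have eq: "\<delta>' q = \<delta> q" by (simp add: \<delta>'_def)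
      then obtain d1 d2 d3 where d: "(d1, d2, d3) \<in> Tr q" "real (W \<delta> q (d1, d2, d3)) \<le> \<tau> q"
        using \<delta>(1) q(1) q'(1) unfolding ok_def by (metis prod_cases3)
      have "W \<delta>' q (d1, d2, d3) \<le> W \<delta> q (d1, d2, d3)"
        using Tr[OF q(1) d(1)] by (auto simp: W_def eq intro!: mult_le_mono diff_le_mono lev)
      with d q'(2)[OF d(1)] show False by linarith
    qed
    have le_b: "lev \<delta>' c - \<delta>' p \<le> b p c" if "p \<in> On c" for c
      using lev[OF that] by (simp add: b_def \<delta>'_def)
    have "W \<delta>' p (c1, c2, c3) \<le> b p c1 * b p c2 * b p c3"
      using Tr[OF p T] unfolding W_def by (auto intro!: mult_le_mono le_b)
    then have "real (W \<delta>' p (c1, c2, c3)) \<le> real (b p c1 * b p c2 * b p c3)" by (rule of_nat_mono)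
    with q'(2) T \<open>q = p\<close> show ?thesis by fastforce
  qed
  ultimately show ?thesis by (intro exI[of _ b]) auto
qed

section \<open>Tangent lines of polynomial curves\<close>

lemma poly_curve_eq_curve_pt:
  "poly_curve p1 p2 p3 = curve_pt (\<lambda>i. if i = 1 then p1 else if i = 2 then p2 else p3)"
  by (rule ext) (simp add: poly_curve_def curve_pt_def vec_eq_iff forall_3)

text \<open>
  The power \<open>k\<close> is the smallest order of vanishing at \<open>t\<close> of the coordinates of \<open>P - x\<close>.
\<close>

lemma leading_direction_exists:
  assumes nonconst: "degree (P i0) > 0" and t: "curve_pt P t = x"
  shows "\<exists>w. leads_at P x t w \<and> w \<noteq> 0"
proof -
  define R where "R i = P i - [:x $ i:]" for i
  have root: "poly (R i) t = 0" for i using t by (auto simp: R_def curve_pt_def)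
  have "R i0 \<noteq> 0"
  proof
    assume "R i0 = 0"
    then have "P i0 = [:x $ i0:]" by (simp add: R_def)
    with nonconst show False by simp
  qed
  let ?N = "{i. R i \<noteq> 0}"
  define k where "k = Min ((\<lambda>i. order t (R i)) ` ?N)"
  have "k \<in> (\<lambda>i. order t (R i)) ` ?N"
    unfolding k_def using \<open>R i0 \<noteq> 0\<close> by (intro Min_in) auto
  then obtain j where j: "R j \<noteq> 0" "k = order t (R j)" by blast
  have "k > 0" using j root[of j] by (simp add: order_gt_0_iff)
  have "[:-t, 1:] ^ k dvd R i" for i
    unfolding order_divides k_def by (cases "R i = 0") (auto intro!: Min_le)
  then have "\<forall>i. \<exists>Q. R i = [:-t, 1:] ^ k * Q" by (auto simp: dvd_def)
  then obtain Q where Q: "\<And>i. R i = [:-t, 1:] ^ k * Q i" by metis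
  have "poly (Q j) t \<noteq> 0"
  proof
    assume "poly (Q j) t = 0"
    then obtain S where "Q j = [:-t, 1:] * S" by (auto simp: poly_eq_0_iff_dvd elim: dvdE)
    then have "R j = [:-t, 1:] ^ Suc k * S" using Q[of j] by (simp only: power_Suc2 mult.assoc)
    then have "[:-t, 1:] ^ Suc k dvd R j" by simp
    with order[OF j(1), of t] j(2) show False by simp
  qed
  then have "curve_pt Q t \<noteq> 0" by (auto simp: curve_pt_def vec_eq_iff)
  moreover have "leads_at P x t (curve_pt Q t)"
    unfolding leads_at_def using \<open>k > 0\<close> Q by (intro exI[of _ k] exI[of _ Q]) (simp add: R_def)
  ultimately show ?thesis by blast
qed

lemma bounded_parameters:
  assumes "degree (P i0) > 0" "bounded (range (\<lambda>n. curve_pt P (\<tau> n)))"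
  shows "bounded (range \<tau>)"
proof -
  obtain K where K: "\<And>n. norm (curve_pt P (\<tau> n)) \<le> K"
    using assms(2) by (auto simp: bounded_iff)
  have "filterlim (poly (P i0)) at_infinity at_infinity"
    by (rule filterlim_poly_at_infinity[OF assms(1)])
  then have "\<forall>\<^sub>F t in at_infinity. norm (poly (P i0) t) \<ge> \<bar>K\<bar> + 1"
    using filterlim_at_infinity[of 0 "poly (P i0)"] by (simp add: add_nonneg_pos)
  then obtain R where R: "\<And>t. \<bar>t\<bar> \<ge> R \<Longrightarrow> \<bar>poly (P i0) t\<bar> \<ge> \<bar>K\<bar> + 1"
    by (auto simp: eventually_at_infinity)
  have "\<bar>\<tau> n\<bar> \<le> R" for n
  proof (rule ccontr)
    assume "\<not> \<bar>\<tau> n\<bar> \<le> R"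
    then have "\<bar>poly (P i0) (\<tau> n)\<bar> \<ge> \<bar>K\<bar> + 1" using R[of "\<tau> n"] by simp
    moreover have "\<bar>poly (P i0) (\<tau> n)\<bar> \<le> norm (curve_pt P (\<tau> n))"
      using component_le_norm_cart[of "curve_pt P (\<tau> n)" i0] by (simp add: curve_pt_def)
    ultimately show False using K[of n] by linarith
  qed
  then show ?thesis by (auto simp: bounded_iff)
qed

lemma tendsto_curve_pt: "\<sigma> \<longlonglongrightarrow> t \<Longrightarrow> (\<lambda>n. curve_pt P (\<sigma> n)) \<longlonglongrightarrow> curve_pt P t"
  unfolding curve_pt_def by (intro tendsto_intros)

lemma line_through_scale:
  assumes "c \<noteq> 0" shows "line_through x (c *\<^sub>R w) = line_through x w"
proof -
  have "x + s *\<^sub>R w \<in> line_through x (c *\<^sub>R w)" for s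
    using assms unfolding line_through_def by (intro image_eqI[of _ _ "s / c"]) auto
  moreover have "x + s *\<^sub>R (c *\<^sub>R w) \<in> line_through x w" for s
    unfolding line_through_def by (intro image_eqI[of _ _ "s * c"]) auto
  ultimately show ?thesis unfolding line_through_def by blast
qed

text \<open>
  Points \<open>f s\<close> of the branch, for \<open>s\<close> tending to \<open>0\<close>, have parameters \<open>\<tau>\<close> on the curve. These stay
  bounded because a non-constant polynomial is proper, so along a subsequence they converge to some \<open>t\<close>,
  and \<open>P(t) = x\<close>. There \<open>(f s - x) / s = ((\<tau> - t) ^ k / s) Q(\<tau>)\<close>, where \<open>Q(\<tau>)\<close> tends to the leading
  direction \<open>W t \<noteq> 0\<close>. Since the left-hand side converges to \<open>d\<close>, so does the scalar factor, and \<open>d\<close> is a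
  multiple of \<open>W t\<close>. The time \<open>t\<close> depends on the branch, whose parametrisation is arbitrary; for this
  reason \<open>W\<close> is given for all times.
\<close>

lemma tangent_direction_is_leading:
  assumes nonconst: "degree (P i0) > 0" and tan: "tangent_line (range (curve_pt P)) x L"
    and W: "\<And>t. curve_pt P t = x \<Longrightarrow> leads_at P x t (W t) \<and> W t \<noteq> 0"
  shows "\<exists>t. curve_pt P t = x \<and> L = line_through x (W t)"
proof -
  obtain \<C> C f d where C: "branch_nbhd (range (curve_pt P)) x \<C>" "C \<in> \<C>" "branch_param x C f"
    and d: "(f has_vector_derivative d) (at 0 within {0..<1})" "d \<noteq> 0" and L: "L = line_through x d"
    using tan unfolding tangent_line_def by blast
  have f0: "f 0 = x" using C(3) by (simp add: branch_param_def)
  have fC: "f s \<in> range (curve_pt P)" if "s \<in> {0..<1}" for s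
    using C that unfolding branch_param_def branch_nbhd_def homeomorphism_def by blast
  define s where "s n = inverse (real (Suc (Suc n)))" for n
  have s01: "s n \<in> {0..<1}" "s n > 0" for n by (auto simp: s_def inverse_less_1_iff)
  have s0: "s \<longlonglongrightarrow> 0" unfolding s_def by (rule LIMSEQ_Suc[OF LIMSEQ_inverse_real_of_nat])
  then have s_at: "filterlim s (at 0 within {0..<1}) sequentially"
    using s01 by (auto simp: filterlim_at less_imp_neq[symmetric])
  have "\<forall>n. \<exists>t. curve_pt P t = f (s n)" using fC[OF s01(1)] by (metis imageE)
  then obtain \<tau> where \<tau>: "\<And>n. curve_pt P (\<tau> n) = f (s n)" by metis
  have "continuous (at 0 within {0..<1}) f"
    using d(1) has_vector_derivative_continuous by blast
  then have fx: "(\<lambda>n. f (s n)) \<longlonglongrightarrow> x"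
    using filterlim_compose[OF _ s_at] f0 by (auto simp: continuous_within)
  then have "bounded (range (\<lambda>n. curve_pt P (\<tau> n)))"
    using convergent_imp_bounded \<tau> by simp
  then have "bounded (range \<tau>)" by (rule bounded_parameters[where \<tau> = \<tau> and P = P, OF nonconst])
  from bounded_imp_convergent_subsequence[OF this]
  obtain t r where r: "strict_mono r" "(\<tau> \<circ> r) \<longlonglongrightarrow> t" by blast
  have lim_r: "(\<lambda>n. X (r n)) \<longlonglongrightarrow> l" if "X \<longlonglongrightarrow> l" for X :: "nat \<Rightarrow> 'z::topological_space" and l
    using LIMSEQ_subseq_LIMSEQ[OF that r(1)] by (simp add: o_def)
  have \<tau>r: "(\<lambda>n. \<tau> (r n)) \<longlonglongrightarrow> t" using r(2) by (simp add: o_def)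
  have t: "curve_pt P t = x"
    using LIMSEQ_unique[OF tendsto_curve_pt[OF \<tau>r, of P]] lim_r[OF fx] by (simp add: \<tau>)
  obtain k Q where k: "k > 0" and Q: "\<And>i. P i - [:x $ i:] = [:-t, 1:] ^ k * Q i"
    and w: "curve_pt Q t = W t" "W t \<noteq> 0"
    using W[OF t] unfolding leads_at_def by blast
  define a where "a n = (\<tau> (r n) - t) ^ k / s (r n)" for n
  have quotient: "(\<lambda>n. a n * poly (Q i) (\<tau> (r n))) \<longlonglongrightarrow> d $ i" for i
  proof -
    have "((\<lambda>y. f y $ i) has_real_derivative d $ i) (at 0 within {0..<1})"
      using bounded_linear.has_vector_derivative[OF bounded_linear_vec_nth d(1)]
      by (simp add: has_real_derivative_iff_has_vector_derivative)
    then have "((\<lambda>y. (f y $ i - x $ i) / y) \<longlongrightarrow> d $ i) (at 0 within {0..<1})"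
      by (simp add: has_field_derivative_iff f0)
    from lim_r[OF filterlim_compose[OF this s_at]]
    have "(\<lambda>n. (f (s (r n)) $ i - x $ i) / s (r n)) \<longlonglongrightarrow> d $ i" .
    moreover have "f (s (r n)) $ i - x $ i = (\<tau> (r n) - t) ^ k * poly (Q i) (\<tau> (r n))" for n
    proof -
      have "poly (P i - [:x $ i:]) (\<tau> (r n)) = poly ([:-t, 1:] ^ k * Q i) (\<tau> (r n))" using Q by simp
      moreover have "f (s (r n)) $ i = poly (P i) (\<tau> (r n))" by (simp add: curve_pt_def flip: \<tau>)
      ultimately show ?thesis by simp
    qed
    ultimately show ?thesis by (simp add: a_def)
  qed
  have Qlim: "(\<lambda>n. poly (Q i) (\<tau> (r n))) \<longlonglongrightarrow> W t $ i" for i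
    using tendsto_vec_nth[OF tendsto_curve_pt[OF \<tau>r, of Q], of i, unfolded w(1)]
    by (simp add: curve_pt_def)
  \<comment> \<open>The scalar factor converges because it is a quotient of two convergent sequences in a coordinate
     where \<open>W t\<close> does not vanish.\<close>
  obtain j where j: "W t $ j \<noteq> 0" using w(2) by (auto simp: vec_eq_iff)
  define c where "c = d $ j / W t $ j"
  have "(\<lambda>n. a n * poly (Q j) (\<tau> (r n)) / poly (Q j) (\<tau> (r n))) \<longlonglongrightarrow> c"
    unfolding c_def by (intro tendsto_divide quotient Qlim j)
  moreover have "\<forall>\<^sub>F n in sequentially. poly (Q j) (\<tau> (r n)) \<noteq> 0"
    using tendsto_imp_eventually_ne[OF Qlim j] .
  ultimately have alim: "a \<longlonglongrightarrow> c"
    by (elim Lim_transform_eventually) (auto elim: eventually_mono)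
  have "d $ i = c * W t $ i" for i
    using LIMSEQ_unique[OF quotient tendsto_mult[OF alim Qlim]] .
  then have "d = c *\<^sub>R W t" by (simp add: vec_eq_iff)
  moreover from this d(2) have "c \<noteq> 0" by auto
  ultimately have "L = line_through x (W t)" by (simp add: L line_through_scale)
  with t show ?thesis by blast
qed

text \<open>
  There is at most one tangent line for each time at which the curve passes through \<open>x\<close>, and those times are
  roots of a polynomial of degree at most \<open>B\<close>.
\<close>

lemma few_tangent_lines:
  assumes nonconst: "degree (P i0) > 0" and deg: "degree (P i0) \<le> B"
  shows "finite {L. tangent_line (range (curve_pt P)) x L}"
    and "card {L. tangent_line (range (curve_pt P)) x L} \<le> B"
    and "tangent_line (range (curve_pt P)) x L \<Longrightarrow> \<exists>t w. leads_at P x t w \<and> L = line_through x w"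
proof -
  obtain W where W: "\<And>t. curve_pt P t = x \<Longrightarrow> leads_at P x t (W t) \<and> W t \<noteq> 0"
    using leading_direction_exists[where P = P, OF nonconst] by metis
  let ?Z = "{t. curve_pt P t = x}" and ?p = "P i0 - [:x $ i0:]"
  have "?p \<noteq> 0"
  proof
    assume "?p = 0"
    then have "P i0 = [:x $ i0:]" by simp
    with nonconst show False by simp
  qed
  then have fin: "finite {t. poly ?p t = 0}" by (rule poly_roots_finite)
  have sub: "?Z \<subseteq> {t. poly ?p t = 0}" by (auto simp: curve_pt_def)
  have finZ: "finite ?Z" using finite_subset[OF sub fin] .
  have "card ?Z \<le> card {t. poly ?p t = 0}" by (rule card_mono[OF fin sub])
  also have "\<dots> \<le> B"
    using card_poly_roots_bound[OF \<open>?p \<noteq> 0\<close>] degree_diff_le[OF deg, of "[:x $ i0:]"] by simp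
  finally have cardZ: "card ?Z \<le> B" .
  have lines: "{L. tangent_line (range (curve_pt P)) x L} \<subseteq> (\<lambda>t. line_through x (W t)) ` ?Z"
    using tangent_direction_is_leading[where P = P, OF nonconst _ W] by blast
  show "finite {L. tangent_line (range (curve_pt P)) x L}"
    using finite_subset[OF lines] finZ by blast
  show "card {L. tangent_line (range (curve_pt P)) x L} \<le> B"
    using surj_card_le[OF finZ lines] cardZ by linarith
  show "\<exists>t w. leads_at P x t w \<and> L = line_through x w" if tan: "tangent_line (range (curve_pt P)) x L"
  proof -
    obtain t where t: "curve_pt P t = x" "L = line_through x (W t)"
      using tangent_direction_is_leading[where P = P and W = W, OF nonconst tan] W by blast
    with W show ?thesis by blast
  qed
qed

section \<open>Joints with multiplicities\<close>

lemma direction_in_span: "line_through x u = line_through x w \<Longrightarrow> u \<in> span {w}"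
proof -
  assume "line_through x u = line_through x w"
  then have "x + 1 *\<^sub>R u \<in> line_through x w" unfolding line_through_def by blast
  then show ?thesis by (auto simp: line_through_def span_singleton)
qed

lemma independent_triple_iff:
  fixes u v w :: "real^3"
  shows "distinct [u, v, w] \<and> independent {u, v, w} \<longleftrightarrow> span {u, v, w} = UNIV"
proof
  assume *: "distinct [u, v, w] \<and> independent {u, v, w}"
  then have "card {u, v, w} = 3" by simp
  then show "span {u, v, w} = UNIV"
    using * card_ge_dim_independent[of "{u, v, w}" UNIV] by (simp add: top.extremum_unique)
next
  assume *: "span {u, v, w} = UNIV"
  then have "3 \<le> card {u, v, w}" using dim_le_card[of UNIV "{u, v, w}"] by simp
  moreover have "card {u, v, w} \<le> 3" by (simp add: card_insert_if)
  ultimately have "card {u, v, w} = 3" by simp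
  moreover from this have "distinct [u, v, w]" using card_distinct[of "[u, v, w]"] by simp
  ultimately show "distinct [u, v, w] \<and> independent {u, v, w}"
    using * card_le_dim_spanning[of "{u, v, w}" UNIV] by simp
qed

text \<open>
  Expanding the cube of \<open>sum b E\<close> gives each unordered triple at least once. This is where the number of
  triples at a joint enters, and it is what produces the exponent \<open>1/2\<close> in the end.
\<close>

lemma card_triples_times_le_cube:
  fixes b :: "'l \<Rightarrow> nat"
  assumes fin: "finite E"
    and T: "\<And>T. T \<in> \<T> \<Longrightarrow> \<exists>l1\<in>E. \<exists>l2\<in>E. \<exists>l3\<in>E. T = {l1, l2, l3} \<and> \<tau> \<le> real (b l1 * b l2 * b l3)"
  shows "real (card \<T>) * \<tau> \<le> real (sum b E) ^ 3"
proof -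
  define good where "good T x = (case x of (l1, l2, l3) \<Rightarrow> l1 \<in> E \<and> l2 \<in> E \<and> l3 \<in> E \<and> T = {l1, l2, l3} \<and>
    \<tau> \<le> real (b l1 * b l2 * b l3))" for T x
  have "\<forall>T\<in>\<T>. \<exists>x. good T x" using T unfolding good_def by fast
  then obtain h where h: "\<And>T. T \<in> \<T> \<Longrightarrow> good T (h T)" by metis
  define val where "val x = (case x of (l1, l2, l3) \<Rightarrow> real (b l1 * b l2 * b l3))" for x
  have hE: "h ` \<T> \<subseteq> E \<times> E \<times> E" using h by (fastforce simp: good_def split: prod.splits)
  have inj: "inj_on h \<T>"
    by (rule inj_on_inverseI[of _ "\<lambda>(l1, l2, l3). {l1, l2, l3}"]) (use h in \<open>fastforce simp: good_def split: prod.splits\<close>)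
  have "real (card \<T>) * \<tau> = (\<Sum>T\<in>\<T>. \<tau>)" by simp
  also have "\<dots> \<le> (\<Sum>T\<in>\<T>. val (h T))"
    using h by (intro sum_mono) (fastforce simp: good_def val_def split: prod.splits)
  also have "\<dots> = (\<Sum>x\<in>h ` \<T>. val x)" by (simp add: sum.reindex[OF inj])
  also have "\<dots> \<le> (\<Sum>x\<in>E \<times> E \<times> E. val x)"
    using fin by (intro sum_mono2 hE) (auto simp: val_def)
  also have "\<dots> = (\<Sum>l1\<in>E. \<Sum>l2\<in>E. \<Sum>l3\<in>E. real (b l1) * (real (b l2) * real (b l3)))"
    unfolding sum.cartesian_product[symmetric] val_def by (simp add: sum.cartesian_product case_prod_unfold mult.assoc)
  also have "\<dots> = real (sum b E) ^ 3"
    by (simp add: power3_eq_cube mult.assoc flip: sum_distrib_left sum_distrib_right)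
  finally show ?thesis .
qed

locale poly_curves =
  fixes \<Gamma> :: "(real^3) set set" and cv :: "(real^3) set \<Rightarrow> 3 \<Rightarrow> real poly" and B :: nat
  assumes finite_\<Gamma>: "finite \<Gamma>"
    and range_cv: "\<And>\<gamma>. \<gamma> \<in> \<Gamma> \<Longrightarrow> \<gamma> = range (curve_pt (cv \<gamma>))"
    and nonconst: "\<And>\<gamma>. \<gamma> \<in> \<Gamma> \<Longrightarrow> \<exists>i. degree (cv \<gamma> i) > 0"
    and deg: "\<And>\<gamma> i. \<gamma> \<in> \<Gamma> \<Longrightarrow> degree (cv \<gamma> i) \<le> B"
begin

definition lines_at :: "real^3 \<Rightarrow> (real^3) set set" where
  "lines_at p = {L. \<exists>\<gamma>\<in>\<Gamma>. p \<in> \<gamma> \<and> tangent_line \<gamma> p L}"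

text \<open>
  Several curves may share a tangent line at \<open>p\<close>, but the multiplicity counts lines; so one curve is
  chosen for each line.
\<close>

definition carrier_of :: "real^3 \<Rightarrow> (real^3) set \<Rightarrow> (real^3) set" where
  "carrier_of p L = (SOME \<gamma>. \<gamma> \<in> \<Gamma> \<and> p \<in> \<gamma> \<and> tangent_line \<gamma> p L)"

lemma carrier_of:
  assumes "L \<in> lines_at p"
  shows "carrier_of p L \<in> \<Gamma>" "p \<in> carrier_of p L" "tangent_line (carrier_of p L) p L"
  using someI_ex[of "\<lambda>\<gamma>. \<gamma> \<in> \<Gamma> \<and> p \<in> \<gamma> \<and> tangent_line \<gamma> p L"] assms
  unfolding lines_at_def carrier_of_def by auto

lemma tangent_lines_of_curve:
  assumes "\<gamma> \<in> \<Gamma>"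
  shows "finite {L. tangent_line \<gamma> p L}" "card {L. tangent_line \<gamma> p L} \<le> B"
    "tangent_line \<gamma> p L \<Longrightarrow> \<exists>t w. leads_at (cv \<gamma>) p t w \<and> L = line_through p w"
proof -
  obtain i where i: "degree (cv \<gamma> i) > 0" using nonconst[OF assms] by blast
  note few = few_tangent_lines[where P = "cv \<gamma>", OF i deg[OF assms], folded range_cv[OF assms]]
  show "finite {L. tangent_line \<gamma> p L}" "card {L. tangent_line \<gamma> p L} \<le> B"
    "tangent_line \<gamma> p L \<Longrightarrow> \<exists>t w. leads_at (cv \<gamma>) p t w \<and> L = line_through p w"
    by (fact few)+
qed

lemma finite_lines_at: "finite (lines_at p)"
proof (rule finite_subset)
  show "lines_at p \<subseteq> (\<Union>\<gamma>\<in>\<Gamma>. {L. tangent_line \<gamma> p L})" by (auto simp: lines_at_def)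
  show "finite (\<Union>\<gamma>\<in>\<Gamma>. {L. tangent_line \<gamma> p L})"
    using finite_\<Gamma> tangent_lines_of_curve(1) by blast
qed

lemma direction_line: "u \<in> tangent_directions \<Gamma> p \<Longrightarrow> line_through p u \<in> lines_at p"
  by (auto simp: tangent_directions_def lines_at_def)

lemma joint_triple_spanning:
  assumes "T \<in> joint_triples \<Gamma> p"
  shows "\<exists>l1\<in>lines_at p. \<exists>l2\<in>lines_at p. \<exists>l3\<in>lines_at p. T = {l1, l2, l3} \<and>
    spanning_triple cv p (carrier_of p l1) (carrier_of p l2) (carrier_of p l3)"
proof -
  obtain u v w where T: "T = {line_through p u, line_through p v, line_through p w}"
    and dir: "u \<in> tangent_directions \<Gamma> p" "v \<in> tangent_directions \<Gamma> p" "w \<in> tangent_directions \<Gamma> p"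
    and ind: "distinct [u, v, w] \<and> independent {u, v, w}"
    using assms unfolding joint_triples_def by blast
  have "\<exists>t w'. leads_at (cv (carrier_of p (line_through p u))) p t w' \<and> u \<in> span {w'}"
    if "u \<in> tangent_directions \<Gamma> p" for u
    using tangent_lines_of_curve(3) carrier_of[OF direction_line[OF that]] direction_in_span by metis
  then obtain t g where g: "\<And>u. u \<in> tangent_directions \<Gamma> p \<Longrightarrow>
      leads_at (cv (carrier_of p (line_through p u))) p (t u) (g u) \<and> u \<in> span {g u}"
    by metis
  have "span {u, v, w} = UNIV" using ind independent_triple_iff by blast
  moreover have "span {u, v, w} \<subseteq> span {g u, g v, g w}"
  proof (rule span_minimal)
    have "x \<in> span {g u, g v, g w}" if "x \<in> span {g x}" "g x \<in> {g u, g v, g w}" for x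
      using that span_mono[of "{g x}" "{g u, g v, g w}"] by blast
    then show "{u, v, w} \<subseteq> span {g u, g v, g w}" using g dir by blast
  qed simp
  ultimately have "spanning_triple cv p (carrier_of p (line_through p u))
      (carrier_of p (line_through p v)) (carrier_of p (line_through p w))"
    using g dir unfolding spanning_triple_def by blast
  then show ?thesis using T dir direction_line by blast
qed

lemma finite_joint_triples: "finite (joint_triples \<Gamma> p)"
proof (rule finite_subset)
  show "joint_triples \<Gamma> p \<subseteq> Pow (lines_at p)" using joint_triple_spanning by fast
qed (simp add: finite_lines_at)

lemma multiplicity_pos: "p \<in> joints \<Gamma> \<Longrightarrow> multiplicity_joint \<Gamma> p > 0"
proof -
  assume "p \<in> joints \<Gamma>"
  then obtain u v w where "u \<in> tangent_directions \<Gamma> p" "v \<in> tangent_directions \<Gamma> p"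
    "w \<in> tangent_directions \<Gamma> p" "distinct [u, v, w] \<and> independent {u, v, w}"
    unfolding joints_def is_joint_def independent_triple_iff by blast
  then have "joint_triples \<Gamma> p \<noteq> {}" unfolding joint_triples_def by blast
  then show ?thesis by (simp add: multiplicity_joint_def card_gt_0_iff finite_joint_triples)
qed

text \<open>
  A curve may be chosen for several lines at \<open>p\<close> if it passes through \<open>p\<close> several times, but for at most \<open>B\<close>.
\<close>

lemma sum_lines_at_le:
  fixes b :: "(real^3) set \<Rightarrow> nat"
  shows "(\<Sum>L\<in>lines_at p. b (carrier_of p L)) \<le> B * (\<Sum>\<gamma> | \<gamma> \<in> \<Gamma> \<and> p \<in> \<gamma>. b \<gamma>)"
proof -
  let ?c = "carrier_of p" and ?E = "lines_at p"
  have "(\<Sum>L\<in>?E. b (?c L)) = (\<Sum>\<gamma>\<in>?c ` ?E. \<Sum>L | L \<in> ?E \<and> ?c L = \<gamma>. b (?c L))"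
    by (rule sum.image_gen[OF finite_lines_at])
  also have "\<dots> = (\<Sum>\<gamma>\<in>?c ` ?E. card {L \<in> ?E. ?c L = \<gamma>} * b \<gamma>)" by simp
  also have "\<dots> \<le> (\<Sum>\<gamma>\<in>?c ` ?E. B * b \<gamma>)"
  proof (intro sum_mono mult_right_mono)
    fix \<gamma> assume "\<gamma> \<in> ?c ` ?E"
    then have \<gamma>: "\<gamma> \<in> \<Gamma>" using carrier_of(1) by blast
    have "{L \<in> ?E. ?c L = \<gamma>} \<subseteq> {L. tangent_line \<gamma> p L}" using carrier_of(3) by blast
    from card_mono[OF tangent_lines_of_curve(1)[OF \<gamma>] this]
    show "card {L \<in> ?E. ?c L = \<gamma>} \<le> B" using tangent_lines_of_curve(2)[OF \<gamma>, of p] by linarith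
  qed simp
  also have "\<dots> \<le> (\<Sum>\<gamma> | \<gamma> \<in> \<Gamma> \<and> p \<in> \<gamma>. B * b \<gamma>)"
    using finite_\<Gamma> carrier_of(1,2) by (intro sum_mono2) auto
  finally show ?thesis by (simp add: sum_distrib_left)
qed

lemma B_pos: "\<Gamma> \<noteq> {} \<Longrightarrow> B > 0"
  using nonconst deg by (metis ex_in_conv gr0I leD)

text \<open>
  Let \<open>S\<close> be the left-hand side, \<open>N p\<close> the multiplicity and \<open>X p\<close> the sum of the weights of the lines at
  \<open>p\<close>. With \<open>\<tau> p = sqrt (N p) m ^ 3 / S\<close> we have \<open>N p * \<tau> p \<le> X p ^ 3\<close>, which is
  \<open>sqrt (N p) m \<le> S powr (1/3) * X p\<close>. Since the weights along each curve add up to \<open>O(m)\<close>, summation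
  over \<open>p\<close> gives \<open>S m \<le> S powr (1/3) * O(m * card \<Gamma>)\<close>. The weight \<open>\<tau>\<close> is chosen so that both
  sides of this summation contain \<open>S\<close>. The degree is \<open>3 * m\<close>, so that the space of polynomials has
  dimension greater than \<open>m ^ 3\<close>; \<open>m\<close> is the number of joints, so that the loss \<open>2 * card J\<close> in the weights is
  absorbed.
\<close>

lemma sum_sqrt_multiplicity_le:
  assumes J: "finite J" "J \<subseteq> joints \<Gamma>"
  shows "(\<Sum>p\<in>J. sqrt (multiplicity_joint \<Gamma> p)) \<le> (6 * real B ^ 2) powr (3/2) * real (card \<Gamma>) powr (3/2)"
proof (cases "J = {}")
  case True
  then show ?thesis by simp
next
  case False
  define N where "N p = multiplicity_joint \<Gamma> p" for p
  define S where "S = (\<Sum>p\<in>J. sqrt (N p))"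
  define m where "m = card J"
  define D where "D = 3 * m * B + 1"
  define \<tau> where "\<tau> p = sqrt (N p) * m ^ 3 / S" for p
  define On where "On \<gamma> = (if \<gamma> \<in> \<Gamma> then J \<inter> \<gamma> else {})" for \<gamma>
  define Tr where "Tr p = {(c1, c2, c3). c1 \<in> \<Gamma> \<and> c2 \<in> \<Gamma> \<and> c3 \<in> \<Gamma> \<and> spanning_triple cv p c1 c2 c3}" for p
  have "sqrt (N p) > 0" if "p \<in> J" for p using multiplicity_pos J(2) that by (auto simp: N_def)
  then have S: "S > 0" unfolding S_def using J(1) False by (intro sum_pos)
  have m: "m > 0" using J(1) False by (simp add: m_def card_gt_0_iff)
  have on: "p \<in> c" if "spanning_triple cv p c1 c2 c3" "c \<in> {c1, c2, c3}" "c \<in> \<Gamma>" for p c c1 c2 c3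
    using that leads_at_imp_curve_pt range_cv[OF that(3)] unfolding spanning_triple_def by blast
  have "\<Gamma> \<noteq> {}" using False J(2) by (auto simp: joints_def is_joint_def)
  then have B: "B > 0" by (rule B_pos)
  have "\<exists>b :: real^3 \<Rightarrow> (real^3) set \<Rightarrow> nat. (\<forall>c. (\<Sum>p\<in>On c. b p c) \<le> D + 2 * card J) \<and>
    (\<forall>p\<in>J. \<forall>(c1, c2, c3)\<in>Tr p. \<tau> p \<le> real (b p c1 * b p c2 * b p c3))"
  proof (rule balanced_weights[OF J(1)])
    show "(\<Sum>p\<in>J. \<tau> p) < real (card (indices (3 * m)))"
    proof -
      have "(\<Sum>p\<in>J. \<tau> p) = S * m ^ 3 / S"
        unfolding \<tau>_def S_def by (simp add: sum_distrib_right sum_divide_distrib)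
      also have "\<dots> = real (m ^ 3)" using S by simp
      finally show ?thesis using card_indices[of m] by (metis of_nat_less_iff)
    qed
    show "p \<in> On c1 \<and> p \<in> On c2 \<and> p \<in> On c3" if "p \<in> J" "(c1, c2, c3) \<in> Tr p" for p c1 c2 c3
      using that on unfolding On_def Tr_def by auto
    show "card (indices (3 * m)) \<le> (\<Sum>p\<in>U. (k (T1 p) - \<delta> p) * (k (T2 p) - \<delta> p) * (k (T3 p) - \<delta> p))"
      if U: "U \<subseteq> J" "U \<noteq> {}" and T: "\<And>p. p \<in> U \<Longrightarrow> (T1 p, T2 p, T3 p) \<in> Tr p"
        and lev: "\<And>c. U \<inter> On c \<noteq> {} \<Longrightarrow> D \<le> (\<Sum>p\<in>U \<inter> On c. k c - \<delta> p)"
      for U \<delta> k T1 T2 T3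
    proof (rule dimension_count[where C = \<Gamma> and B = B and D = D and cv = cv])
      show "finite U" using finite_subset[OF U(1) J(1)] .
      show "3 * m * B < D" by (simp add: D_def)
      fix c assume c: "c \<in> \<Gamma>" "U \<inter> range (curve_pt (cv c)) \<noteq> {}"
      have "U \<inter> range (curve_pt (cv c)) = U \<inter> On c"
        using c(1) U(1) range_cv[OF c(1), symmetric] by (auto simp: On_def)
      then show "D \<le> (\<Sum>p\<in>U \<inter> range (curve_pt (cv c)). k c - \<delta> p)" using lev c(2) by simp
    qed (use U T deg in \<open>auto simp: Tr_def\<close>)
  qed (use S in \<open>auto simp: On_def D_def \<tau>_def\<close>)
  then obtain b where b: "\<And>c. (\<Sum>p\<in>On c. b p c) \<le> D + 2 * card J"
    "\<And>p c1 c2 c3. p \<in> J \<Longrightarrow> (c1, c2, c3) \<in> Tr p \<Longrightarrow> \<tau> p \<le> real (b p c1 * b p c2 * b p c3)"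
    by fast
  define X where "X p = (\<Sum>L\<in>lines_at p. b p (carrier_of p L))" for p
  define \<sigma> where "\<sigma> = root 3 S"
  have \<sigma>: "\<sigma> > 0" "\<sigma> ^ 3 = S" using S by (auto simp: \<sigma>_def)
  have X: "sqrt (N p) * m \<le> \<sigma> * X p" if p: "p \<in> J" for p
  proof -
    have "real (card (joint_triples \<Gamma> p)) * \<tau> p \<le> real (X p) ^ 3"
      unfolding X_def
    proof (rule card_triples_times_le_cube[OF finite_lines_at])
      fix T assume "T \<in> joint_triples \<Gamma> p"
      from joint_triple_spanning[OF this] obtain l1 l2 l3 where
        l: "l1 \<in> lines_at p" "l2 \<in> lines_at p" "l3 \<in> lines_at p" "T = {l1, l2, l3}"
        "spanning_triple cv p (carrier_of p l1) (carrier_of p l2) (carrier_of p l3)" by blast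
      then have "(carrier_of p l1, carrier_of p l2, carrier_of p l3) \<in> Tr p"
        using carrier_of(1) by (simp add: Tr_def)
      from b(2)[OF p this] l show "\<exists>l1\<in>lines_at p. \<exists>l2\<in>lines_at p. \<exists>l3\<in>lines_at p. T = {l1, l2, l3} \<and>
          \<tau> p \<le> real (b p (carrier_of p l1) * b p (carrier_of p l2) * b p (carrier_of p l3))" by blast
    qed
    then have "real (N p) * \<tau> p \<le> real (X p) ^ 3" by (simp add: N_def multiplicity_joint_def)
    moreover have "real (N p) * \<tau> p = (sqrt (N p) * m) ^ 3 / \<sigma> ^ 3"
    proof -
      have "real (N p) * sqrt (N p) = sqrt (N p) ^ 3" by (simp add: power3_eq_cube)
      then show ?thesis unfolding \<tau>_def \<sigma>(2) power_mult_distrib by (simp flip: mult.assoc)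
    qed
    ultimately have "(sqrt (N p) * m) ^ 3 / \<sigma> ^ 3 \<le> real (X p) ^ 3" by simp
    then have "(sqrt (N p) * m) ^ 3 \<le> real (X p) ^ 3 * \<sigma> ^ 3"
      using \<sigma>(1) by (subst (asm) pos_divide_le_eq) auto
    also have "\<dots> = (\<sigma> * X p) ^ 3" by (simp add: power_mult_distrib)
    finally have "(sqrt (N p) * m) ^ 3 \<le> (\<sigma> * X p) ^ 3" .
    then show ?thesis using \<sigma>(1) by (subst (asm) power_mono_iff) auto
  qed
  have "sum X J \<le> (\<Sum>p\<in>J. B * (\<Sum>\<gamma> | \<gamma> \<in> \<Gamma> \<and> p \<in> \<gamma>. b p \<gamma>))"
    unfolding X_def by (intro sum_mono sum_lines_at_le)
  also have "\<dots> = B * (\<Sum>\<gamma>\<in>\<Gamma>. \<Sum>p | p \<in> J \<and> p \<in> \<gamma>. b p \<gamma>)"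
    unfolding sum_distrib_left[symmetric] by (subst sum.swap_restrict[OF J(1) finite_\<Gamma>]) simp
  also have "\<dots> \<le> B * (\<Sum>\<gamma>\<in>\<Gamma>. 6 * m * B)"
  proof (intro mult_left_mono sum_mono)
    fix \<gamma> assume "\<gamma> \<in> \<Gamma>"
    then have "(\<Sum>p | p \<in> J \<and> p \<in> \<gamma>. b p \<gamma>) \<le> D + 2 * card J"
      using b(1)[of \<gamma>] by (simp add: On_def Int_def)
    moreover have "m * 1 \<le> m * B" using B by (intro mult_left_mono) auto
    ultimately show "(\<Sum>p | p \<in> J \<and> p \<in> \<gamma>. b p \<gamma>) \<le> 6 * m * B"
      using m unfolding D_def m_def[symmetric] by linarith
  qed simp
  finally have sumX: "sum X J \<le> 6 * B ^ 2 * card \<Gamma> * m" by (simp add: power2_eq_square mult_ac)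
  have "\<sigma> ^ 3 * m = (\<Sum>p\<in>J. sqrt (N p) * m)" by (simp add: \<sigma>(2) S_def sum_distrib_right)
  also have "\<dots> \<le> (\<Sum>p\<in>J. \<sigma> * X p)" by (intro sum_mono X)
  also have "\<dots> = \<sigma> * real (sum X J)" by (simp add: sum_distrib_left)
  also have "\<dots> \<le> \<sigma> * real (6 * B ^ 2 * card \<Gamma> * m)"
    using sumX \<sigma>(1) by (intro mult_left_mono of_nat_mono) auto
  finally have "\<sigma> ^ 2 \<le> 6 * B ^ 2 * card \<Gamma>"
    using \<sigma>(1) m by (simp add: power3_eq_cube power2_eq_square mult_ac)
  then have "(\<sigma> ^ 2) powr (3/2) \<le> (6 * B ^ 2 * card \<Gamma>) powr (3/2)"
    by (intro powr_mono2) auto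
  also have "(\<sigma> ^ 2) powr (3/2) = \<sigma> ^ 3"
    using \<sigma>(1) by (simp add: powr_powr flip: powr_numeral)
  finally show ?thesis by (simp add: \<sigma>(2) S_def N_def powr_mult)
qed

text \<open>
  Multiplicities are at least \<open>1\<close>, so the bound for finite sets of joints also bounds their cardinality.
\<close>

lemma finite_joints: "finite (joints \<Gamma>)"
proof (rule ccontr)
  assume "infinite (joints \<Gamma>)"
  define K where "K = (6 * real B ^ 2) powr (3/2) * real (card \<Gamma>) powr (3/2)"
  obtain J where J: "J \<subseteq> joints \<Gamma>" "finite J" "card J = nat \<lceil>K\<rceil> + 1"
    using infinite_arbitrarily_large[OF \<open>infinite (joints \<Gamma>)\<close>] by blast
  have "real (card J) = (\<Sum>p\<in>J. 1)" by simp
  also have "\<dots> \<le> (\<Sum>p\<in>J. sqrt (multiplicity_joint \<Gamma> p))"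
    using multiplicity_pos J(1) by (intro sum_mono) (auto simp: Suc_le_eq subset_iff)
  also have "\<dots> \<le> K" unfolding K_def by (rule sum_sqrt_multiplicity_le[OF J(2,1)])
  finally show False using J(3) by linarith
qed

end

theorem corollary4p5:
  fixes b :: real
  assumes "b > 0"
  shows "\<exists>c::real. \<forall>\<Gamma>::(real^3) set set.
    finite \<Gamma> \<and>
    (\<forall>\<gamma>\<in>\<Gamma>. \<exists>p1 p2 p3 :: real poly.
       \<gamma> = range (poly_curve p1 p2 p3) \<and>
       \<not> (degree p1 = 0 \<and> degree p2 = 0 \<and> degree p3 = 0) \<and>
       real (degree p1) \<le> b \<and> real (degree p2) \<le> b \<and> real (degree p3) \<le> b) \<longrightarrow>
    finite (joints \<Gamma>) \<and>
    (\<forall>x\<in>joints \<Gamma>. finite (joint_triples \<Gamma> x)) \<and>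
    (\<Sum>x\<in>joints \<Gamma>. real (multiplicity_joint \<Gamma> x) powr (1/2)) \<le> c * real (card \<Gamma>) powr (3/2)"
proof (intro exI allI impI)
  define B where "B = nat \<lfloor>b\<rfloor>"
  fix \<Gamma> :: "(real^3) set set"
  assume \<Gamma>: "finite \<Gamma> \<and>
    (\<forall>\<gamma>\<in>\<Gamma>. \<exists>p1 p2 p3 :: real poly.
       \<gamma> = range (poly_curve p1 p2 p3) \<and>
       \<not> (degree p1 = 0 \<and> degree p2 = 0 \<and> degree p3 = 0) \<and>
       real (degree p1) \<le> b \<and> real (degree p2) \<le> b \<and> real (degree p3) \<le> b)"
  have "\<forall>\<gamma>\<in>\<Gamma>. \<exists>P. \<gamma> = range (curve_pt P) \<and> (\<exists>i. degree (P i) > 0) \<and> (\<forall>i. degree (P i) \<le> B)"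
  proof
    fix \<gamma> assume "\<gamma> \<in> \<Gamma>"
    then obtain p1 p2 p3 :: "real poly" where p: "\<gamma> = range (poly_curve p1 p2 p3)"
       "\<not> (degree p1 = 0 \<and> degree p2 = 0 \<and> degree p3 = 0)"
       "real (degree p1) \<le> b" "real (degree p2) \<le> b" "real (degree p3) \<le> b"
      using \<Gamma> by blast
    define P :: "3 \<Rightarrow> real poly" where "P i = (if i = 1 then p1 else if i = 2 then p2 else p3)" for i
    have "\<forall>i. degree (P i) \<le> B"
      using p(3-5) unfolding P_def B_def forall_3 by (simp add: le_nat_floor)
    moreover have "\<not> (\<forall>i. degree (P i) = 0)"
      using p(2) unfolding P_def forall_3 by simp
    moreover have "\<gamma> = range (curve_pt P)"
      using p(1) unfolding poly_curve_eq_curve_pt P_def .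
    ultimately show "\<exists>P. \<gamma> = range (curve_pt P) \<and> (\<exists>i. degree (P i) > 0) \<and> (\<forall>i. degree (P i) \<le> B)"
      by (intro exI[of _ P]) auto
  qed
  then obtain cv where "\<And>\<gamma>. \<gamma> \<in> \<Gamma> \<Longrightarrow> \<gamma> = range (curve_pt (cv \<gamma>)) \<and>
      (\<exists>i. degree (cv \<gamma> i) > 0) \<and> (\<forall>i. degree (cv \<gamma> i) \<le> B)"
    by metis
  then interpret poly_curves \<Gamma> cv B
    using \<Gamma> by unfold_locales auto
  show "finite (joints \<Gamma>) \<and> (\<forall>x\<in>joints \<Gamma>. finite (joint_triples \<Gamma> x)) \<and>
    (\<Sum>x\<in>joints \<Gamma>. real (multiplicity_joint \<Gamma> x) powr (1/2)) \<le>
      (6 * real (nat \<lfloor>b\<rfloor>) ^ 2) powr (3/2) * real (card \<Gamma>) powr (3/2)"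
    using finite_joints finite_joint_triples sum_sqrt_multiplicity_le[OF finite_joints order_refl]
    by (simp add: powr_half_sqrt B_def)
qed

end
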